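(* Intuitionistic first-order logic is sound and complete with respect to potentialist Kripke semantics. That is, for all formulas $\varphi_1,\dots,\varphi_n,\psi$ of the first-order language $\mathcal{L}$: $\psi$ is intuitionistically deducible from $\varphi_1,\dots,\varphi_n$ if and only if, for every potentialist Kripke model, every world $w$ and every assignment of elements of the domain $\mathrm{Dom}(w)$ to the free variables, if $w\Vdash\varphi_i$ for all $i=1,\dots,n$, then $w\Vdash\psi$.
   Context: $\mathcal{L}$ is a first-order language with a relational signature and logical operators $\neg,\wedge,\vee,\to,\forall,\exists$. A *potentialist Kripke model* consists of a non-empty set $W$ of worlds, two accessibility relations $\leq_D$ and $\leq_G$ on $W$, a non-empty domain $\mathrm{Dom}(w)$ for each $w\in W$, and, for each world $w$, an interpretation at $w$ of each atomic predicate as a relation on $\mathrm{Dom}(w)$, such that: - $\leq_D$ is reflexive and transitive; - $\leq_G$ is reflexive, transitive and convergent (if $w_0\leq_G w_1$ and $w_0\leq_G w_2$, there is $w_3$ with $w_1\leq_G w_3$ and $w_2\leq_G w_3$); - $w\leq_G w'$ implies $w\leq_D w'$; - mixed convergence: if $w_0\leq_G w_1$ and $w_0\leq_D w_2$, there is $w_3$ with $w_1\leq_D w_3$ and $w_2\leq_G w_3$; - $w\leq_D w'$ implies $\mathrm{Dom}(w)\subseteq\mathrm{Dom}(w')$; - atomic predications are G-stable: if $w\leq_G w'$ and $\vec a$ are in $\mathrm{Dom}(w)$, then $P(\vec a)$ holds at $w$ iff $P(\vec a)$ holds at $w'$. (If $\mathcal{L}$ contains identity, it is treated as one of the atomic predicates,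 interpreted at each world by an equivalence relation that is a congruence for the other predicates at that world and that is preserved along $\leq_D$.) The relation $\Vdash$ between worlds and formulas (with parameters from the domain of the world) is defined by: - $w\Vdash P(\vec a)$ iff $P(\vec a)$ holds at every $w'\geq_D w$; - $w\Vdash\varphi\wedge\psi$ iff $w\Vdash\varphi$ and $w\Vdash\psi$; $w\Vdash\varphi\vee\psi$ iff $w\Vdash\varphi$ or $w\Vdash\psi$; - $w\Vdash\varphi\to\psi$ iff for every $w'\geq_D w$, $w'\Vdash\varphi$ implies $w'\Vdash\psi$; - $w\Vdash\neg\varphi$ iff for no $w'\geq_D w$ do we have $w'\Vdash\varphi$; - $w\Vdash\exists x\,\varphi(x)$ iff there are $w'\geq_G w$ and $a\in\mathrm{Dom}(w')$ with $w'\Vdash\varphi(a)$; - $w\Vdash\forall x\,\varphi(x)$ iff for every $w'\geq_D w$ and every $a\in\mathrm{Dom}(w')$, $w'\Vdash\varphi(a)$. *)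

theory Defs
  imports Main
begin

section \<open>Relational first-order languages\<close>

text \<open>
  The predicate symbols of a language are the elements of a type. At most one of them, of arity 2,
  is designated as the identity symbol. A language without predicate symbols has no formulas at
  all (there is no falsum), so nothing is lost by types being non-empty.
\<close>

record 'p language =
  arity :: "'p \<Rightarrow> nat"
  identity :: "'p option"

definition language_wf :: "'p language \<Rightarrow> bool" where
  "language_wf L \<longleftrightarrow> (\<forall>q. identity L = Some q \<longrightarrow> arity L q = 2)"

text \<open>
  Formulas are de Bruijn terms: variable 0 is the one bound by the innermost enclosing quantifier,
  and a free variable \<open>n\<close> occurs under \<open>k\<close> quantifiers as \<open>n + k\<close>. The signature being relational,
  variables are the only terms.
\<close>

datatype 'p form =
    Atom 'p "nat list"
  | Neg "'p form"
  | Conj "'p form" "'p form"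
  | Disj "'p form" "'p form"
  | Imp "'p form" "'p form"
  | Forall "'p form"
  | Exists "'p form"

primrec wff :: "'p language \<Rightarrow> 'p form \<Rightarrow> bool" where
  "wff L (Atom p xs) \<longleftrightarrow> length xs = arity L p"
| "wff L (Neg \<phi>) \<longleftrightarrow> wff L \<phi>"
| "wff L (Conj \<phi> \<psi>) \<longleftrightarrow> wff L \<phi> \<and> wff L \<psi>"
| "wff L (Disj \<phi> \<psi>) \<longleftrightarrow> wff L \<phi> \<and> wff L \<psi>"
| "wff L (Imp \<phi> \<psi>) \<longleftrightarrow> wff L \<phi> \<and> wff L \<psi>"
| "wff L (Forall \<phi>) \<longleftrightarrow> wff L \<phi>"
| "wff L (Exists \<phi>) \<longleftrightarrow> wff L \<phi>"

primrec fvars :: "'p form \<Rightarrow> nat set" where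
  "fvars (Atom p xs) = set xs"
| "fvars (Neg \<phi>) = fvars \<phi>"
| "fvars (Conj \<phi> \<psi>) = fvars \<phi> \<union> fvars \<psi>"
| "fvars (Disj \<phi> \<psi>) = fvars \<phi> \<union> fvars \<psi>"
| "fvars (Imp \<phi> \<psi>) = fvars \<phi> \<union> fvars \<psi>"
| "fvars (Forall \<phi>) = {n. Suc n \<in> fvars \<phi>}"
| "fvars (Exists \<phi>) = {n. Suc n \<in> fvars \<phi>}"

text \<open>Simultaneous capture-avoiding substitution of variables for free variables.\<close>

primrec rename :: "(nat \<Rightarrow> nat) \<Rightarrow> 'p form \<Rightarrow> 'p form" where
  "rename r (Atom p xs) = Atom p (map r xs)"
| "rename r (Neg \<phi>) = Neg (rename r \<phi>)"
| "rename r (Conj \<phi> \<psi>) = Conj (rename r \<phi>) (rename r \<psi>)"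
| "rename r (Disj \<phi> \<psi>) = Disj (rename r \<phi>) (rename r \<psi>)"
| "rename r (Imp \<phi> \<psi>) = Imp (rename r \<phi>) (rename r \<psi>)"
| "rename r (Forall \<phi>) = Forall (rename (case_nat 0 (\<lambda>n. Suc (r n))) \<phi>)"
| "rename r (Exists \<phi>) = Exists (rename (case_nat 0 (\<lambda>n. Suc (r n))) \<phi>)"

text \<open>
  \<open>lift\<close> makes variable 0 fresh; \<open>inst y \<phi>\<close> replaces variable 0 by \<open>y\<close> and lowers the other
  variables, i.e. it is \<open>\<phi>(y)\<close> for the body \<open>\<phi>\<close> of a quantified formula.
\<close>

definition lift :: "'p form \<Rightarrow> 'p form" where
  "lift \<phi> = rename Suc \<phi>"

definition inst :: "nat \<Rightarrow> 'p form \<Rightarrow> 'p form" where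
  "inst y \<phi> = rename (case_nat y (\<lambda>n. n)) \<phi>"


section \<open>Intuitionistic natural deduction\<close>

text \<open>
  The well-formedness premises ensure that every formula in a derivation belongs to \<open>L\<close>. The last
  two rules apply only if \<open>L\<close> contains identity.
\<close>

inductive deducible :: "'p language \<Rightarrow> 'p form list \<Rightarrow> 'p form \<Rightarrow> bool"
  for L :: "'p language" where
  Assumption: "\<forall>\<theta>\<in>set \<Gamma>. wff L \<theta> \<Longrightarrow> \<phi> \<in> set \<Gamma> \<Longrightarrow> deducible L \<Gamma> \<phi>"
| NegI: "deducible L (\<phi> # \<Gamma>) \<psi> \<Longrightarrow> deducible L (\<phi> # \<Gamma>) (Neg \<psi>) \<Longrightarrow> deducible L \<Gamma> (Neg \<phi>)"
| NegE: "deducible L \<Gamma> \<phi> \<Longrightarrow> deducible L \<Gamma> (Neg \<phi>) \<Longrightarrow> wff L \<psi> \<Longrightarrow> deducible L \<Gamma> \<psi>"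
| ConjI: "deducible L \<Gamma> \<phi> \<Longrightarrow> deducible L \<Gamma> \<psi> \<Longrightarrow> deducible L \<Gamma> (Conj \<phi> \<psi>)"
| ConjE1: "deducible L \<Gamma> (Conj \<phi> \<psi>) \<Longrightarrow> deducible L \<Gamma> \<phi>"
| ConjE2: "deducible L \<Gamma> (Conj \<phi> \<psi>) \<Longrightarrow> deducible L \<Gamma> \<psi>"
| DisjI1: "deducible L \<Gamma> \<phi> \<Longrightarrow> wff L \<psi> \<Longrightarrow> deducible L \<Gamma> (Disj \<phi> \<psi>)"
| DisjI2: "deducible L \<Gamma> \<psi> \<Longrightarrow> wff L \<phi> \<Longrightarrow> deducible L \<Gamma> (Disj \<phi> \<psi>)"
| DisjE: "deducible L \<Gamma> (Disj \<phi> \<psi>) \<Longrightarrow> deducible L (\<phi> # \<Gamma>) \<chi> \<Longrightarrow> deducible L (\<psi> # \<Gamma>) \<chi> \<Longrightarrow>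
    deducible L \<Gamma> \<chi>"
| ImpI: "deducible L (\<phi> # \<Gamma>) \<psi> \<Longrightarrow> deducible L \<Gamma> (Imp \<phi> \<psi>)"
| ImpE: "deducible L \<Gamma> (Imp \<phi> \<psi>) \<Longrightarrow> deducible L \<Gamma> \<phi> \<Longrightarrow> deducible L \<Gamma> \<psi>"
| ForallI: "deducible L (map lift \<Gamma>) \<phi> \<Longrightarrow> deducible L \<Gamma> (Forall \<phi>)"
| ForallE: "deducible L \<Gamma> (Forall \<phi>) \<Longrightarrow> deducible L \<Gamma> (inst y \<phi>)"
| ExistsI: "deducible L \<Gamma> (inst y \<phi>) \<Longrightarrow> deducible L \<Gamma> (Exists \<phi>)"
| ExistsE: "deducible L \<Gamma> (Exists \<phi>) \<Longrightarrow> deducible L (\<phi> # map lift \<Gamma>) (lift \<chi>) \<Longrightarrow>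
    deducible L \<Gamma> \<chi>"
| IdentI: "identity L = Some q \<Longrightarrow> \<forall>\<theta>\<in>set \<Gamma>. wff L \<theta> \<Longrightarrow> deducible L \<Gamma> (Atom q [x, x])"
| IdentE: "identity L = Some q \<Longrightarrow> deducible L \<Gamma> (Atom q [x, y]) \<Longrightarrow> deducible L \<Gamma> (inst x \<phi>) \<Longrightarrow>
    deducible L \<Gamma> (inst y \<phi>)"


section \<open>Potentialist Kripke models\<close>

record ('w, 'd, 'p) kripke_model =
  Worlds :: "'w set"
  LeD :: "('w \<times> 'w) set"
  LeG :: "('w \<times> 'w) set"
  Dom :: "'w \<Rightarrow> 'd set"
  Interp :: "'w \<Rightarrow> 'p \<Rightarrow> 'd list set"

locale potentialist_kripke_model =
  fixes L :: "'p language" and M :: "('w, 'd, 'p) kripke_model"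
  assumes Worlds_nonempty: "Worlds M \<noteq> {}"
    and Dom_nonempty: "w \<in> Worlds M \<Longrightarrow> Dom M w \<noteq> {}"
    and Interp_subset: "w \<in> Worlds M \<Longrightarrow> Interp M w p \<subseteq> {as \<in> lists (Dom M w). length as = arity L p}"
    and LeD_preorder: "preorder_on (Worlds M) (LeD M)"
    and LeG_preorder: "preorder_on (Worlds M) (LeG M)"
    and LeG_convergent: "(w0, w1) \<in> LeG M \<Longrightarrow> (w0, w2) \<in> LeG M \<Longrightarrow>
      \<exists>w3. (w1, w3) \<in> LeG M \<and> (w2, w3) \<in> LeG M"
    and LeG_subset_LeD: "LeG M \<subseteq> LeD M"
    and mixed_convergent: "(w0, w1) \<in> LeG M \<Longrightarrow> (w0, w2) \<in> LeD M \<Longrightarrow>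
      \<exists>w3. (w1, w3) \<in> LeD M \<and> (w2, w3) \<in> LeG M"
    and Dom_mono: "(w, w') \<in> LeD M \<Longrightarrow> Dom M w \<subseteq> Dom M w'"
    and Interp_G_stable: "(w, w') \<in> LeG M \<Longrightarrow> as \<in> lists (Dom M w) \<Longrightarrow>
      as \<in> Interp M w p \<longleftrightarrow> as \<in> Interp M w' p"
    and identity_equiv: "identity L = Some q \<Longrightarrow> w \<in> Worlds M \<Longrightarrow>
      equiv (Dom M w) {(a, b). [a, b] \<in> Interp M w q}"
    and identity_congruence: "identity L = Some q \<Longrightarrow> w \<in> Worlds M \<Longrightarrow> p \<noteq> q \<Longrightarrow>
      list_all2 (\<lambda>a b. [a, b] \<in> Interp M w q) as bs \<Longrightarrow>
      as \<in> Interp M w p \<longleftrightarrow> bs \<in> Interp M w p"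
    and identity_D_stable: "identity L = Some q \<Longrightarrow> (w, w') \<in> LeD M \<Longrightarrow>
      [a, b] \<in> Interp M w q \<Longrightarrow> [a, b] \<in> Interp M w' q"

text \<open>
  In \<open>forces M w e \<phi>\<close> the parameters of \<open>\<phi>\<close> are given by the assignment \<open>e\<close>; \<open>case_nat a e\<close> assigns
  \<open>a\<close> to the variable bound by the outermost quantifier.
\<close>

primrec forces :: "('w, 'd, 'p) kripke_model \<Rightarrow> 'w \<Rightarrow> (nat \<Rightarrow> 'd) \<Rightarrow> 'p form \<Rightarrow> bool" where
  "forces M w e (Atom p xs) \<longleftrightarrow> (\<forall>w'. (w, w') \<in> LeD M \<longrightarrow> map e xs \<in> Interp M w' p)"
| "forces M w e (Neg \<phi>) \<longleftrightarrow> \<not> (\<exists>w'. (w, w') \<in> LeD M \<and> forces M w' e \<phi>)"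
| "forces M w e (Conj \<phi> \<psi>) \<longleftrightarrow> forces M w e \<phi> \<and> forces M w e \<psi>"
| "forces M w e (Disj \<phi> \<psi>) \<longleftrightarrow> forces M w e \<phi> \<or> forces M w e \<psi>"
| "forces M w e (Imp \<phi> \<psi>) \<longleftrightarrow>
    (\<forall>w'. (w, w') \<in> LeD M \<longrightarrow> forces M w' e \<phi> \<longrightarrow> forces M w' e \<psi>)"
| "forces M w e (Forall \<phi>) \<longleftrightarrow>
    (\<forall>w'. (w, w') \<in> LeD M \<longrightarrow> (\<forall>a\<in>Dom M w'. forces M w' (case_nat a e) \<phi>))"
| "forces M w e (Exists \<phi>) \<longleftrightarrow>
    (\<exists>w'. (w, w') \<in> LeG M \<and> (\<exists>a\<in>Dom M w'. forces M w' (case_nat a e) \<phi>))"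

definition preserves_forcing :: "('w, 'd, 'p) kripke_model \<Rightarrow> 'p form list \<Rightarrow> 'p form \<Rightarrow> bool" where
  "preserves_forcing M \<Gamma> \<psi> \<longleftrightarrow>
    (\<forall>w\<in>Worlds M. \<forall>e. (\<forall>\<phi>\<in>insert \<psi> (set \<Gamma>). \<forall>x\<in>fvars \<phi>. e x \<in> Dom M w) \<longrightarrow>
      (\<forall>\<phi>\<in>set \<Gamma>. forces M w e \<phi>) \<longrightarrow> forces M w e \<psi>)"

end

theory Submission
  imports Defs "HOL-Library.Countable_Set" "HOL-Library.Nat_Bijection"
begin

text \<open>
  Soundness rests on two properties of forcing. It persists along \<open>LeD\<close> (\<open>forces_LeD\<close>), which is
  what the rules for implication, negation and the universal quantifier use, and it is reflected
  along \<open>LeG\<close> (\<open>forces_LeG_reflect\<close>). The second property is what existential elimination uses: a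
  witness for an existential formula forced at \<open>w\<close> may only be found at a world \<open>w'\<close> that is
  \<open>LeG\<close>-above \<open>w\<close>, so the conclusion is obtained at \<open>w'\<close> and has to be brought back to \<open>w\<close>. Both
  properties follow from mixed convergence. If \<open>w\<close> lies \<open>LeG\<close>-below \<open>w'\<close> and \<open>v\<close> is any
  \<open>LeD\<close>-extension of \<open>w\<close>, then some \<open>u\<close> is both a \<open>LeD\<close>-extension of \<open>w'\<close> and a \<open>LeG\<close>-extension of
  \<open>v\<close>; hence whatever holds throughout the \<open>LeD\<close>-extensions of \<open>w'\<close> holds at \<open>u\<close>, and is inherited
  by \<open>v\<close> because \<open>LeG\<close> changes nothing.

  For completeness, an ordinary Kripke model of intuitionistic logic is a potentialist one in
  which \<open>LeG\<close> is equality: the convergence conditions are then trivial, and the existential clause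
  becomes the usual one, with the witness in the domain of the world itself. So it suffices to
  build an ordinary countermodel by Henkin's method. Its worlds are prime, deductively closed
  theories with witnesses (\<open>saturated\<close>), over sets of variables that grow along the order, and a
  world forces exactly the formulas in its theory (\<open>truth_lemma\<close>).

  There may be uncountably many such theories, while the countermodel is to have countably many
  worlds. The truth lemma does not need all of them, only an extension refuting \<open>\<chi>\<close> for every
  theory and every negation, implication or universal formula \<open>\<chi>\<close> outside it
  (\<open>refuting_extension\<close>). Choosing one such extension for each theory and each \<open>\<chi>\<close> gives a tree of
  theories indexed by finite lists of requests (\<open>refutation_complete_family\<close>), which is countable
  because the formulas built from the predicate symbols of the given sequent and identity are
  countable, whatever the size of the language.
\<close>

section \<open>Renaming of variables\<close>

lemma case_nat_shift: "case_nat a f (case_nat 0 (\<lambda>n. Suc (g n)) k) = case_nat a (\<lambda>n. f (g n)) k"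
  by (cases k) auto

lemma rename_rename: "rename r (rename s \<phi>) = rename (\<lambda>n. r (s n)) \<phi>"
  by (induction \<phi> arbitrary: r s) (auto simp: case_nat_shift)

lemma rename_cong: "\<forall>x\<in>fvars \<phi>. r x = s x \<Longrightarrow> rename r \<phi> = rename s \<phi>"
proof (induction \<phi> arbitrary: r s)
  case (Forall \<phi>)
  have "\<forall>x\<in>fvars \<phi>. case_nat 0 (\<lambda>n. Suc (r n)) x = case_nat 0 (\<lambda>n. Suc (s n)) x"
    using Forall.prems by (auto split: nat.split)
  then show ?case using Forall.IH by simp
next
  case (Exists \<phi>)
  have "\<forall>x\<in>fvars \<phi>. case_nat 0 (\<lambda>n. Suc (r n)) x = case_nat 0 (\<lambda>n. Suc (s n)) x"
    using Exists.prems by (auto split: nat.split)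
  then show ?case using Exists.IH by simp
qed (simp_all add: ball_Un)

lemma rename_ident: "rename (\<lambda>n. n) \<phi> = \<phi>"
proof (induction \<phi>)
  case (Forall \<phi>)
  have "case_nat 0 Suc = (\<lambda>n. n)" by (rule ext) (simp split: nat.split)
  then show ?case using Forall by simp
next
  case (Exists \<phi>)
  have "case_nat 0 Suc = (\<lambda>n. n)" by (rule ext) (simp split: nat.split)
  then show ?case using Exists by simp
qed simp_all

lemma wff_rename [simp]: "wff L (rename r \<phi>) = wff L \<phi>"
  by (induction \<phi> arbitrary: r) auto

lemma wff_lift [simp]: "wff L (lift \<phi>) = wff L \<phi>"
  by (simp add: lift_def)

lemma wff_inst [simp]: "wff L (inst y \<phi>) = wff L \<phi>"
  by (simp add: inst_def)

lemma size_inst: "size (inst y \<phi>) = size \<phi>"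
proof -
  have "size (rename r \<phi>) = size \<phi>" for r by (induction \<phi> arbitrary: r) auto
  then show ?thesis by (simp add: inst_def)
qed

lemma set_form_inst [simp]: "set_form (inst y \<phi>) = set_form \<phi>"
proof -
  have "set_form (rename r \<phi>) = set_form \<phi>" for r by (induction \<phi> arbitrary: r) auto
  then show ?thesis by (simp add: inst_def)
qed

lemma finite_fvars [simp]: "finite (fvars \<phi>)"
proof (induction \<phi>)
  case (Forall \<phi>)
  then show ?case using finite_vimageI[of "fvars \<phi>" Suc] by (simp add: vimage_def)
next
  case (Exists \<phi>)
  then show ?case using finite_vimageI[of "fvars \<phi>" Suc] by (simp add: vimage_def)
qed auto

lemma fvars_rename: "fvars (rename r \<phi>) \<subseteq> r ` fvars \<phi>"
proof (induction \<phi> arbitrary: r)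
  case (Forall \<phi>)
  show ?case
  proof
    fix x assume "x \<in> fvars (rename r (Forall \<phi>))"
    then have "Suc x \<in> case_nat 0 (\<lambda>n. Suc (r n)) ` fvars \<phi>"
      using Forall[of "case_nat 0 (\<lambda>n. Suc (r n))"] by auto
    then show "x \<in> r ` fvars (Forall \<phi>)" by (auto split: nat.splits)
  qed
next
  case (Exists \<phi>)
  show ?case
  proof
    fix x assume "x \<in> fvars (rename r (Exists \<phi>))"
    then have "Suc x \<in> case_nat 0 (\<lambda>n. Suc (r n)) ` fvars \<phi>"
      using Exists[of "case_nat 0 (\<lambda>n. Suc (r n))"] by auto
    then show "x \<in> r ` fvars (Exists \<phi>)" by (auto split: nat.splits)
  qed
qed (simp_all add: image_Un le_supI1 le_supI2)

lemma fvars_inst: "fvars (inst y \<phi>) \<subseteq> insert y {n. Suc n \<in> fvars \<phi>}"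
  using fvars_rename[of "case_nat y (\<lambda>n. n)" \<phi>] by (fastforce simp: inst_def split: nat.splits)

lemma rename_lift: "rename (case_nat 0 (\<lambda>n. Suc (r n))) (lift \<phi>) = lift (rename r \<phi>)"
  by (simp add: lift_def rename_rename)

lemma rename_inst: "rename r (inst y \<phi>) = inst (r y) (rename (case_nat 0 (\<lambda>n. Suc (r n))) \<phi>)"
proof -
  have "(\<lambda>n. r (case_nat y (\<lambda>n. n) n)) = case_nat (r y) r"
    by (auto split: nat.split)
  then show ?thesis by (simp add: inst_def rename_rename case_nat_shift)
qed

text \<open>
  Abstraction over a variable \<open>y\<close>: renaming \<open>y\<close> to 0 while lifting all other variables. It undoes
  an instantiation with a fresh \<open>y\<close>, and on formulas without \<open>y\<close> it is just \<open>lift\<close>. This is how a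
  named eigenvariable is converted into a de Bruijn index.
\<close>

definition abstract :: "nat \<Rightarrow> 'p form \<Rightarrow> 'p form" where
  "abstract y = rename (\<lambda>n. if n = y then 0 else Suc n)"

lemma abstract_inst:
  assumes "Suc y \<notin> fvars \<phi>"
  shows "abstract y (inst y \<phi>) = \<phi>"
proof -
  have "abstract y (inst y \<phi>) = rename (\<lambda>n. n) \<phi>"
    unfolding abstract_def inst_def rename_rename
    by (rule rename_cong) (use assms in \<open>auto split: nat.split\<close>)
  then show ?thesis by (simp add: rename_ident)
qed

lemma abstract_fresh: "y \<notin> fvars \<phi> \<Longrightarrow> abstract y \<phi> = lift \<phi>"
  unfolding abstract_def lift_def by (rule rename_cong) auto

section \<open>Structural properties of deducibility\<close>

lemma deducible_wff:
  assumes "deducible L \<Gamma> \<phi>" "language_wf L"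
  shows "(\<forall>\<theta>\<in>set \<Gamma>. wff L \<theta>) \<and> wff L \<phi>"
  using assms by (induction rule: deducible.induct) (auto simp: language_wf_def)

lemma deducible_weaken:
  assumes "deducible L \<Gamma> \<phi>" "set \<Gamma> \<subseteq> set \<Delta>" "\<forall>\<theta>\<in>set \<Delta>. wff L \<theta>" "language_wf L"
  shows "deducible L \<Delta> \<phi>"
  using assms
proof (induction arbitrary: \<Delta> rule: deducible.induct)
  case (NegI \<phi> \<Gamma> \<psi>)
  have "wff L \<phi>" using deducible_wff[OF NegI.hyps(1) NegI.prems(3)] by auto
  then have \<Delta>: "set (\<phi> # \<Gamma>) \<subseteq> set (\<phi> # \<Delta>)" "\<forall>\<theta>\<in>set (\<phi> # \<Delta>). wff L \<theta>"
    using NegI.prems by auto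
  show ?case
    by (rule deducible.NegI[OF NegI.IH(1)[OF \<Delta> NegI.prems(3)] NegI.IH(2)[OF \<Delta> NegI.prems(3)]])
next
  case (DisjE \<Gamma> \<phi> \<psi> \<chi>)
  have "wff L \<phi>" "wff L \<psi>" using deducible_wff[OF DisjE.hyps(1) DisjE.prems(3)] by auto
  then have "deducible L (\<phi> # \<Delta>) \<chi>"
    using DisjE.prems by (intro DisjE.IH(2)) auto
  moreover have "deducible L (\<psi> # \<Delta>) \<chi>"
    using DisjE.prems \<open>wff L \<psi>\<close> by (intro DisjE.IH(3)) auto
  ultimately show ?case by (rule deducible.DisjE[OF DisjE.IH(1)[OF DisjE.prems]])
next
  case (ImpI \<phi> \<Gamma> \<psi>)
  have "wff L \<phi>" using deducible_wff[OF ImpI.hyps(1) ImpI.prems(3)] by auto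
  then have "deducible L (\<phi> # \<Delta>) \<psi>" using ImpI.prems by (auto intro!: ImpI.IH)
  then show ?case by (rule deducible.ImpI)
next
  case (ForallI \<Gamma> \<phi>)
  have "deducible L (map lift \<Delta>) \<phi>" using ForallI.prems by (intro ForallI.IH) auto
  then show ?case by (rule deducible.ForallI)
next
  case (ExistsE \<Gamma> \<phi> \<chi>)
  have "wff L \<phi>" using deducible_wff[OF ExistsE.hyps(1) ExistsE.prems(3)] by auto
  then have "deducible L (\<phi> # map lift \<Delta>) (lift \<chi>)"
    using ExistsE.prems by (intro ExistsE.IH(2)) auto
  then show ?case by (rule deducible.ExistsE[OF ExistsE.IH(1)[OF ExistsE.prems]])
next
  case (IdentE q \<Gamma> x y \<phi>)
  then show ?case by - (rule deducible.IdentE[of _ q _ x y \<phi>], auto)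
next
  case (NegE \<Gamma> \<phi> \<psi>)
  then show ?case by - (rule deducible.NegE[of _ _ \<phi>], auto)
next
  case (ConjE1 \<Gamma> \<phi> \<psi>)
  then show ?case by - (rule deducible.ConjE1[of _ _ \<phi> \<psi>], auto)
next
  case (ConjE2 \<Gamma> \<phi> \<psi>)
  then show ?case by - (rule deducible.ConjE2[of _ _ \<phi> \<psi>], auto)
next
  case (ImpE \<Gamma> \<phi> \<psi>)
  then show ?case by - (rule deducible.ImpE[of _ _ \<phi> \<psi>], auto)
next
  case (ExistsI \<Gamma> y \<phi>)
  then show ?case by - (rule deducible.ExistsI[of _ _ y], auto)
next
  case (Assumption \<Gamma> \<phi>)
  then show ?case by - (rule deducible.Assumption, auto)
next
  case (ConjI \<Gamma> \<phi> \<psi>)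
  then show ?case by - (rule deducible.ConjI, auto)
next
  case (DisjI1 \<Gamma> \<phi> \<psi>)
  then show ?case by - (rule deducible.DisjI1, auto)
next
  case (DisjI2 \<Gamma> \<psi> \<phi>)
  then show ?case by - (rule deducible.DisjI2, auto)
next
  case (ForallE \<Gamma> \<phi> y)
  then show ?case by - (rule deducible.ForallE, auto)
next
  case (IdentI q \<Gamma> x)
  then show ?case by - (rule deducible.IdentI, auto)
qed

lemma deducible_rename:
  "deducible L \<Gamma> \<phi> \<Longrightarrow> deducible L (map (rename r) \<Gamma>) (rename r \<phi>)"
proof (induction arbitrary: r rule: deducible.induct)
  case (Assumption \<Gamma> \<phi>)
  then show ?case by - (rule deducible.Assumption, auto)
next
  case (NegI \<phi> \<Gamma> \<psi>)
  show ?case using NegI.IH[of r] by (simp add: deducible.NegI)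
next
  case (NegE \<Gamma> \<phi> \<psi>)
  show ?case
    using NegE.IH(2)[of r] NegE.hyps(3) by - (rule deducible.NegE[OF NegE.IH(1)], auto)
next
  case (ConjI \<Gamma> \<phi> \<psi>)
  then show ?case by (simp add: deducible.ConjI)
next
  case (ConjE1 \<Gamma> \<phi> \<psi>)
  then show ?case by - (rule deducible.ConjE1[of _ _ _ "rename r \<psi>"], auto)
next
  case (ConjE2 \<Gamma> \<phi> \<psi>)
  then show ?case by - (rule deducible.ConjE2[of _ _ "rename r \<phi>"], auto)
next
  case (DisjI1 \<Gamma> \<phi> \<psi>)
  then show ?case by (simp add: deducible.DisjI1)
next
  case (DisjI2 \<Gamma> \<psi> \<phi>)
  then show ?case by (simp add: deducible.DisjI2)
next
  case (DisjE \<Gamma> \<phi> \<psi> \<chi>)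
  then show ?case by - (rule deducible.DisjE[of _ _ "rename r \<phi>" "rename r \<psi>"], auto)
next
  case (ImpI \<phi> \<Gamma> \<psi>)
  show ?case using ImpI.IH[of r] by (simp add: deducible.ImpI)
next
  case (ImpE \<Gamma> \<phi> \<psi>)
  then show ?case by - (rule deducible.ImpE[of _ _ "rename r \<phi>"], auto)
next
  case (ForallI \<Gamma> \<phi>)
  show ?case using ForallI.IH[of "case_nat 0 (\<lambda>n. Suc (r n))"]
    by (simp add: deducible.ForallI rename_lift comp_def)
next
  case (ForallE \<Gamma> \<phi> y)
  show ?case using ForallE.IH[of r] by (simp add: deducible.ForallE rename_inst)
next
  case (ExistsI \<Gamma> y \<phi>)
  show ?case using ExistsI.IH[of r]
    by (simp add: rename_inst deducible.ExistsI)
next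
  case (ExistsE \<Gamma> \<phi> \<chi>)
  show ?case using ExistsE.IH(1)[of r] ExistsE.IH(2)[of "case_nat 0 (\<lambda>n. Suc (r n))"]
    by (simp add: rename_lift comp_def deducible.ExistsE)
next
  case (IdentI q \<Gamma> x)
  then show ?case by (simp add: deducible.IdentI)
next
  case (IdentE q \<Gamma> x y \<phi>)
  show ?case using IdentE.IH[of r] IdentE.hyps(1)
    by (simp add: rename_inst deducible.IdentE)
qed

text \<open>
  The next two lemmas are the quantifier rules with a named eigenvariable \<open>y\<close>. Abstracting over
  \<open>y\<close> in the whole derivation, which is possible because derivations are closed under renaming,
  turns them into the de Bruijn rules.
\<close>

lemma deducible_Forall_fresh:
  assumes "deducible L \<Gamma> (inst y \<phi>)" "\<forall>\<theta>\<in>set \<Gamma>. y \<notin> fvars \<theta>" "y \<notin> fvars (Forall \<phi>)"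
  shows "deducible L \<Gamma> (Forall \<phi>)"
proof (rule deducible.ForallI)
  have "map (abstract y) \<Gamma> = map lift \<Gamma>" using assms(2) by (auto simp: abstract_fresh)
  moreover have "abstract y (inst y \<phi>) = \<phi>" using assms(3) by (simp add: abstract_inst)
  ultimately show "deducible L (map lift \<Gamma>) \<phi>"
    using deducible_rename[OF assms(1)] unfolding abstract_def by metis
qed

lemma deducible_Exists_fresh:
  assumes "deducible L \<Gamma> (Exists \<phi>)" "deducible L (inst y \<phi> # \<Gamma>) \<chi>"
    and "\<forall>\<theta>\<in>set \<Gamma>. y \<notin> fvars \<theta>" "y \<notin> fvars (Exists \<phi>)" "y \<notin> fvars \<chi>"
  shows "deducible L \<Gamma> \<chi>"
proof (rule deducible.ExistsE[OF assms(1)])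
  have "map (abstract y) (inst y \<phi> # \<Gamma>) = \<phi> # map lift \<Gamma>"
    using assms(3,4) by (auto simp: abstract_fresh abstract_inst)
  moreover have "abstract y \<chi> = lift \<chi>" using assms(5) by (simp add: abstract_fresh)
  ultimately show "deducible L (\<phi> # map lift \<Gamma>) (lift \<chi>)"
    using deducible_rename[OF assms(2)] unfolding abstract_def by metis
qed

section \<open>Soundness\<close>

lemma forces_rename: "forces M w e (rename r \<phi>) \<longleftrightarrow> forces M w (\<lambda>n. e (r n)) \<phi>"
  by (induction \<phi> arbitrary: w e r) (auto simp: case_nat_shift comp_def)

lemma range_case_nat: "range (case_nat a e) = insert a (range e)"
  by (auto simp: image_iff split: nat.splits)

lemma forces_lift: "forces M w (case_nat a e) (lift \<phi>) \<longleftrightarrow> forces M w e \<phi>"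
  by (simp add: lift_def forces_rename)

lemma forces_inst: "forces M w e (inst y \<phi>) \<longleftrightarrow> forces M w (case_nat (e y) e) \<phi>"
proof -
  have "(\<lambda>n. e (case_nat y (\<lambda>n. n) n)) = case_nat (e y) e" by (auto split: nat.split)
  then show ?thesis by (simp add: inst_def forces_rename)
qed

lemma forces_cong:
  "\<forall>x\<in>fvars \<phi>. e x = e' x \<Longrightarrow> forces M w e \<phi> \<longleftrightarrow> forces M w e' \<phi>"
proof (induction \<phi> arbitrary: w e e')
  case (Atom p xs)
  then have "map e xs = map e' xs" by simp
  then show ?case by (simp only: forces.simps)
next
  case (Neg \<phi>)
  from Neg.IH[of e e'] Neg.prems show ?case by simp
next
  case (Conj \<phi> \<psi>)
  from Conj.IH(1)[of e e'] Conj.IH(2)[of e e'] Conj.prems show ?case by (simp add: ball_Un)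
next
  case (Disj \<phi> \<psi>)
  from Disj.IH(1)[of e e'] Disj.IH(2)[of e e'] Disj.prems show ?case by (simp add: ball_Un)
next
  case (Imp \<phi> \<psi>)
  from Imp.IH(1)[of e e'] Imp.IH(2)[of e e'] Imp.prems show ?case by (simp add: ball_Un)
next
  case (Forall \<phi>)
  have "forces M w (case_nat a e) \<phi> \<longleftrightarrow> forces M w (case_nat a e') \<phi>" for a w
    by (rule Forall.IH) (use Forall.prems in \<open>auto split: nat.split\<close>)
  then show ?case by simp
next
  case (Exists \<phi>)
  have "forces M w (case_nat a e) \<phi> \<longleftrightarrow> forces M w (case_nat a e') \<phi>" for a w
    by (rule Exists.IH) (use Exists.prems in \<open>auto split: nat.split\<close>)
  then show ?case by simp
qed

context potentialist_kripke_model
begin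

lemma LeD_Worlds: "(v, w) \<in> LeD M \<Longrightarrow> v \<in> Worlds M \<and> w \<in> Worlds M"
  using LeD_preorder by (auto simp: preorder_on_def refl_on_def)

lemma LeD_refl: "w \<in> Worlds M \<Longrightarrow> (w, w) \<in> LeD M"
  using LeD_preorder by (auto simp: preorder_on_def refl_on_def)

lemma LeD_trans: "(u, v) \<in> LeD M \<Longrightarrow> (v, w) \<in> LeD M \<Longrightarrow> (u, w) \<in> LeD M"
  using LeD_preorder by (auto simp: preorder_on_def dest: transD)

lemma LeG_refl: "w \<in> Worlds M \<Longrightarrow> (w, w) \<in> LeG M"
  using LeG_preorder by (auto simp: preorder_on_def refl_on_def)

lemma LeG_trans: "(u, v) \<in> LeG M \<Longrightarrow> (v, w) \<in> LeG M \<Longrightarrow> (u, w) \<in> LeG M"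
  using LeG_preorder by (auto simp: preorder_on_def dest: transD)

text \<open>
  The clauses that quantify over all \<open>LeD\<close>-extensions persist by transitivity. For the existential
  clause, mixed convergence carries the \<open>LeG\<close>-extension that holds the witness over to the new
  world.
\<close>

lemma forces_LeD:
  "forces M w e \<phi> \<Longrightarrow> (w, w') \<in> LeD M \<Longrightarrow> forces M w' e \<phi>"
proof (induction \<phi> arbitrary: w w' e)
  case (Exists \<phi>)
  then obtain v a where v: "(w, v) \<in> LeG M" "a \<in> Dom M v" "forces M v (case_nat a e) \<phi>" by auto
  obtain u where u: "(v, u) \<in> LeD M" "(w', u) \<in> LeG M"
    using mixed_convergent[OF v(1) Exists.prems(2)] by blast
  have "forces M u (case_nat a e) \<phi>" using Exists.IH v(3) u(1) by blast
  then show ?case using u v(2) Dom_mono[OF u(1)] by auto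
qed (auto intro: LeD_trans)

text \<open>
  In each case that speaks about a \<open>LeD\<close>-extension \<open>v\<close> of \<open>w\<close>, mixed convergence supplies a world
  \<open>u\<close> above both \<open>w'\<close> and \<open>v\<close> with \<open>v\<close> \<open>LeG\<close>-below \<open>u\<close>; antecedents go up from \<open>v\<close> to \<open>u\<close> by
  persistence and consequents come back by the induction hypothesis or, for atoms, by G-stability.
  G-stability is the reason why the assignment must have its values in the smaller domain.
\<close>

lemma forces_LeG_reflect:
  "(w, w') \<in> LeG M \<Longrightarrow> range e \<subseteq> Dom M w \<Longrightarrow> forces M w' e \<phi> \<Longrightarrow> forces M w e \<phi>"
proof (induction \<phi> arbitrary: w w' e)
  case (Atom p xs)
  show ?case unfolding forces.simps
  proof (intro allI impI)
    fix v assume v: "(w, v) \<in> LeD M"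
    then obtain u where u: "(w', u) \<in> LeD M" "(v, u) \<in> LeG M"
      using mixed_convergent[OF Atom.prems(1)] by blast
    have "map e xs \<in> lists (Dom M v)" using Atom.prems(2) Dom_mono[OF v] by fastforce
    then show "map e xs \<in> Interp M v p" using Interp_G_stable[OF u(2)] Atom.prems(3) u(1) by auto
  qed
next
  case (Neg \<phi>)
  show ?case unfolding forces.simps
  proof
    assume "\<exists>v. (w, v) \<in> LeD M \<and> forces M v e \<phi>"
    then obtain v where v: "(w, v) \<in> LeD M" "forces M v e \<phi>" by blast
    then obtain u where "(w', u) \<in> LeD M" "(v, u) \<in> LeG M"
      using mixed_convergent[OF Neg.prems(1)] by blast
    then show False using Neg.prems(3) forces_LeD[OF v(2)] LeG_subset_LeD by auto
  qed
next
  case (Imp \<phi> \<psi>)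
  show ?case unfolding forces.simps
  proof (intro allI impI)
    fix v assume v: "(w, v) \<in> LeD M" "forces M v e \<phi>"
    then obtain u where u: "(w', u) \<in> LeD M" "(v, u) \<in> LeG M"
      using mixed_convergent[OF Imp.prems(1)] by blast
    have "forces M u e \<phi>" using forces_LeD[OF v(2)] u LeG_subset_LeD by auto
    then have "forces M u e \<psi>" using Imp.prems(3) u(1) by auto
    then show "forces M v e \<psi>" using Imp.IH(2)[OF u(2)] Imp.prems(2) Dom_mono[OF v(1)] by auto
  qed
next
  case (Forall \<phi>)
  show ?case unfolding forces.simps
  proof (intro allI impI ballI)
    fix v a assume v: "(w, v) \<in> LeD M" and a: "a \<in> Dom M v"
    then obtain u where u: "(w', u) \<in> LeD M" "(v, u) \<in> LeG M"
      using mixed_convergent[OF Forall.prems(1)] by blast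
    have "a \<in> Dom M u" using u(2) a LeG_subset_LeD Dom_mono by blast
    then have "forces M u (case_nat a e) \<phi>" using Forall.prems(3) u(1) by auto
    moreover have "range (case_nat a e) \<subseteq> Dom M v"
      using a Forall.prems(2) Dom_mono[OF v] by (auto simp: range_case_nat)
    ultimately show "forces M v (case_nat a e) \<phi>" using Forall.IH[OF u(2)] by blast
  qed
next
  case (Exists \<phi>)
  then show ?case using LeG_trans by auto blast
qed (simp; blast)+

lemma identity_refl:
  "identity L = Some q \<Longrightarrow> w \<in> Worlds M \<Longrightarrow> a \<in> Dom M w \<Longrightarrow> [a, a] \<in> Interp M w q"
  using identity_equiv[of q w] by (auto elim!: equivE dest: refl_onD)

lemma identity_sym:
  "identity L = Some q \<Longrightarrow> w \<in> Worlds M \<Longrightarrow> [a, b] \<in> Interp M w q \<Longrightarrow> [b, a] \<in> Interp M w q"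
  using identity_equiv[of q w] by (auto elim!: equivE dest: symD)

lemma identity_trans:
  "identity L = Some q \<Longrightarrow> w \<in> Worlds M \<Longrightarrow> [a, b] \<in> Interp M w q \<Longrightarrow> [b, c] \<in> Interp M w q \<Longrightarrow>
    [a, c] \<in> Interp M w q"
  using identity_equiv[of q w] by (auto elim!: equivE dest: transD)

text \<open>
  Pointwise identity of the assignments survives the passage to later worlds because identity is
  preserved along \<open>LeD\<close>, and it is symmetric, which is what the contravariant positions
  (antecedents and negated formulas) require.
\<close>

lemma forces_identity_cong:
  assumes "identity L = Some q"
  shows "w \<in> Worlds M \<Longrightarrow> (\<And>x. [e x, e' x] \<in> Interp M w q) \<Longrightarrow> forces M w e \<phi> \<Longrightarrow> forces M w e' \<phi>"
proof (induction \<phi> arbitrary: w e e')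
  case (Atom p xs)
  show ?case unfolding forces.simps
  proof (intro allI impI)
    fix v assume v: "(w, v) \<in> LeD M"
    then have vW: "v \<in> Worlds M" using LeD_Worlds by blast
    have eq: "[e x, e' x] \<in> Interp M v q" for x
      using identity_D_stable[OF assms v] Atom.prems(2) by blast
    have e: "map e xs \<in> Interp M v p" using Atom.prems(3) v by auto
    show "map e' xs \<in> Interp M v p"
    proof (cases "p = q")
      case False
      have "list_all2 (\<lambda>a b. [a, b] \<in> Interp M v q) (map e xs) (map e' xs)"
        using eq by (induction xs) auto
      then show ?thesis using identity_congruence[OF assms vW False] e by blast
    next
      case True
      have "length (map e xs) = length [e 0, e' 0]"
        using subsetD[OF Interp_subset[OF vW, of q] eq[of 0]]
          subsetD[OF Interp_subset[OF vW, of q], of "map e xs"] e True by simp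
      then obtain x y where xs: "xs = [x, y]" by (auto simp: length_Suc_conv)
      have "[e x, e y] \<in> Interp M v q" using e xs True by simp
      then have "[e' x, e' y] \<in> Interp M v q"
        by (rule identity_trans[OF assms vW identity_trans[OF assms vW identity_sym[OF assms vW eq]] eq])
      then show ?thesis using xs True by simp
    qed
  qed
next
  case (Neg \<phi>)
  have sym: "[e' x, e x] \<in> Interp M w q" for x
    by (rule identity_sym[OF assms Neg.prems(1) Neg.prems(2)])
  show ?case unfolding forces.simps
  proof
    assume "\<exists>v. (w, v) \<in> LeD M \<and> forces M v e' \<phi>"
    then obtain v where v: "(w, v) \<in> LeD M" "forces M v e' \<phi>" by blast
    have "forces M v e \<phi>"
      using Neg.IH[of v e' e] v LeD_Worlds identity_D_stable[OF assms v(1)] sym by blast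
    then show False using Neg.prems(3) v(1) by auto
  qed
next
  case (Imp \<phi> \<psi>)
  have sym: "[e' x, e x] \<in> Interp M w q" for x
    by (rule identity_sym[OF assms Imp.prems(1) Imp.prems(2)])
  show ?case unfolding forces.simps
  proof (intro allI impI)
    fix v assume v: "(w, v) \<in> LeD M" "forces M v e' \<phi>"
    have "forces M v e \<phi>"
      using Imp.IH(1)[of v e' e] v LeD_Worlds identity_D_stable[OF assms v(1)] sym by blast
    then have "forces M v e \<psi>" using Imp.prems(3) v(1) by auto
    then show "forces M v e' \<psi>"
      using Imp.IH(2)[of v e e'] v(1) LeD_Worlds identity_D_stable[OF assms v(1)] Imp.prems(2) by blast
  qed
next
  case (Forall \<phi>)
  show ?case unfolding forces.simps
  proof (intro allI impI ballI)
    fix v a assume v: "(w, v) \<in> LeD M" and a: "a \<in> Dom M v"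
    have "[a, a] \<in> Interp M v q"
      using LeD_Worlds[OF v] a by (intro identity_refl[OF assms]) auto
    then have "[case_nat a e x, case_nat a e' x] \<in> Interp M v q" for x
      using identity_D_stable[OF assms v] Forall.prems(2) by (cases x) auto
    moreover have "forces M v (case_nat a e) \<phi>" using Forall.prems(3) v a by auto
    ultimately show "forces M v (case_nat a e') \<phi>" using Forall.IH LeD_Worlds v by blast
  qed
next
  case (Exists \<phi>)
  then obtain v a where v: "(w, v) \<in> LeG M" "a \<in> Dom M v" "forces M v (case_nat a e) \<phi>" by auto
  have vD: "(w, v) \<in> LeD M" using v(1) LeG_subset_LeD by blast
  have "[a, a] \<in> Interp M v q"
    using LeD_Worlds[OF vD] v(2) by (intro identity_refl[OF assms]) auto
  then have "[case_nat a e x, case_nat a e' x] \<in> Interp M v q" for x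
    using identity_D_stable[OF assms vD] Exists.prems(2) by (cases x) auto
  then have "forces M v (case_nat a e') \<phi>" using Exists.IH LeD_Worlds vD v(3) by blast
  then show ?case using v by auto
qed (simp; blast)+

text \<open>
  The assignment is required to take all its values in the domain, not just those at the free
  variables of the sequent: premises of a rule such as implication elimination may contain
  variables that do not occur in its conclusion.
\<close>

lemma soundness:
  "deducible L \<Gamma> \<phi> \<Longrightarrow> w \<in> Worlds M \<Longrightarrow> range e \<subseteq> Dom M w \<Longrightarrow>
    \<forall>\<theta>\<in>set \<Gamma>. forces M w e \<theta> \<Longrightarrow> forces M w e \<phi>"
proof (induction arbitrary: w e rule: deducible.induct)
  case (NegI \<phi> \<Gamma> \<psi>)
  show ?case unfolding forces.simps
  proof
    assume "\<exists>v. (w, v) \<in> LeD M \<and> forces M v e \<phi>"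
    then obtain v where v: "(w, v) \<in> LeD M" "forces M v e \<phi>" by blast
    have *: "v \<in> Worlds M" "range e \<subseteq> Dom M v" "\<forall>\<theta>\<in>set (\<phi> # \<Gamma>). forces M v e \<theta>"
      using v LeD_Worlds Dom_mono[OF v(1)] NegI.prems forces_LeD by auto
    show False using NegI.IH(1)[OF *] NegI.IH(2)[OF *] LeD_refl[OF *(1)] by auto
  qed
next
  case (NegE \<Gamma> \<phi> \<psi>)
  show ?case using NegE.IH[OF NegE.prems] LeD_refl[OF NegE.prems(1)] by auto
next
  case (DisjE \<Gamma> \<phi> \<psi> \<chi>)
  show ?case using DisjE.IH(1)[OF DisjE.prems] DisjE.IH(2,3)[OF DisjE.prems(1,2)] DisjE.prems(3)
    by auto
next
  case (ImpI \<phi> \<Gamma> \<psi>)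
  show ?case unfolding forces.simps
  proof (intro allI impI)
    fix v assume v: "(w, v) \<in> LeD M" "forces M v e \<phi>"
    then show "forces M v e \<psi>"
      using LeD_Worlds Dom_mono[OF v(1)] ImpI.prems forces_LeD by (intro ImpI.IH) auto
  qed
next
  case (ImpE \<Gamma> \<phi> \<psi>)
  show ?case using ImpE.IH[OF ImpE.prems] LeD_refl[OF ImpE.prems(1)] by auto
next
  case (ForallI \<Gamma> \<phi>)
  show ?case unfolding forces.simps
  proof (intro allI impI ballI)
    fix v a assume v: "(w, v) \<in> LeD M" and a: "a \<in> Dom M v"
    have "v \<in> Worlds M" "range (case_nat a e) \<subseteq> Dom M v"
      "\<forall>\<theta>\<in>set (map lift \<Gamma>). forces M v (case_nat a e) \<theta>"
      using v a LeD_Worlds Dom_mono[OF v] ForallI.prems forces_LeD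
      by (auto simp: forces_lift range_case_nat)
    then show "forces M v (case_nat a e) \<phi>" by (rule ForallI.IH)
  qed
next
  case (ForallE \<Gamma> \<phi> y)
  have "e y \<in> Dom M w" using ForallE.prems(2) by blast
  then show ?case
    using ForallE.IH[OF ForallE.prems] LeD_refl[OF ForallE.prems(1)] by (auto simp: forces_inst)
next
  case (ExistsI \<Gamma> y \<phi>)
  have "e y \<in> Dom M w" using ExistsI.prems(2) by blast
  then show ?case
    using ExistsI.IH[OF ExistsI.prems] LeG_refl[OF ExistsI.prems(1)] by (auto simp: forces_inst)
next
  case (ExistsE \<Gamma> \<phi> \<chi>)
  obtain v a where v: "(w, v) \<in> LeG M" "a \<in> Dom M v" "forces M v (case_nat a e) \<phi>"
    using ExistsE.IH(1)[OF ExistsE.prems] by auto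
  have vD: "(w, v) \<in> LeD M" using v(1) LeG_subset_LeD by blast
  have "v \<in> Worlds M" "range (case_nat a e) \<subseteq> Dom M v"
    "\<forall>\<theta>\<in>set (\<phi> # map lift \<Gamma>). forces M v (case_nat a e) \<theta>"
    using v vD LeD_Worlds Dom_mono[OF vD] ExistsE.prems forces_LeD
    by (auto simp: forces_lift range_case_nat)
  then have "forces M v (case_nat a e) (lift \<chi>)" by (rule ExistsE.IH(2))
  then show ?case using forces_LeG_reflect[OF v(1) ExistsE.prems(2)] by (simp add: forces_lift)
next
  case (IdentI q \<Gamma> x)
  have "[e x, e x] \<in> Interp M v q" if "(w, v) \<in> LeD M" for v
    using LeD_Worlds[OF that] Dom_mono[OF that] IdentI.prems(2)
    by (intro identity_refl[OF IdentI.hyps(1)]) auto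
  then show ?case by simp
next
  case (IdentE q \<Gamma> x y \<phi>)
  have xy: "[e x, e y] \<in> Interp M w q"
    using IdentE.IH(1)[OF IdentE.prems] LeD_refl[OF IdentE.prems(1)] by auto
  have "[e z, e z] \<in> Interp M w q" for z
    by (rule identity_refl[OF IdentE.hyps(1) IdentE.prems(1)]) (use IdentE.prems(2) in blast)
  then have "[case_nat (e x) e z, case_nat (e y) e z] \<in> Interp M w q" for z
    using xy by (cases z) auto
  then show ?case
    using forces_identity_cong[OF IdentE.hyps(1) IdentE.prems(1)] IdentE.IH(2)[OF IdentE.prems]
    unfolding forces_inst by blast
qed auto

lemma deducible_preserves_forcing:
  assumes "deducible L \<Gamma> \<psi>"
  shows "preserves_forcing M \<Gamma> \<psi>"
  unfolding preserves_forcing_def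
proof (intro ballI allI impI)
  fix w e
  assume w: "w \<in> Worlds M" and e: "\<forall>\<phi>\<in>insert \<psi> (set \<Gamma>). \<forall>x\<in>fvars \<phi>. e x \<in> Dom M w"
    and \<Gamma>: "\<forall>\<phi>\<in>set \<Gamma>. forces M w e \<phi>"
  \<comment> \<open>Variables outside the sequent may have values outside the domain; these are reset to \<open>d\<close>.\<close>
  obtain d where d: "d \<in> Dom M w" using Dom_nonempty[OF w] by blast
  define e' where "e' x = (if e x \<in> Dom M w then e x else d)" for x
  have eq: "forces M w e' \<phi> \<longleftrightarrow> forces M w e \<phi>" if "\<phi> \<in> insert \<psi> (set \<Gamma>)" for \<phi>
    by (rule forces_cong) (use e that in \<open>auto simp: e'_def\<close>)
  have "range e' \<subseteq> Dom M w" using d by (auto simp: e'_def)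
  then have "forces M w e' \<psi>" using soundness[OF assms w] \<Gamma> eq by blast
  then show "forces M w e \<psi>" using eq by blast
qed

end


section \<open>Enumerating the formulas\<close>

instance form :: (countable) countable
  by countable_datatype

text \<open>
  The type of predicate symbols may be uncountable, so formulas are coded by relabelling their
  predicate symbols, drawn from the countable set \<open>P\<close>, with natural numbers.
\<close>

lemma enumeration_of_formulas:
  assumes "countable P"
  obtains enum :: "nat \<Rightarrow> 'p form" where "{\<phi>. set_form \<phi> \<subseteq> P} \<subseteq> range enum"
proof -
  let ?g = "from_nat_into P" and ?f = "to_nat_on P"
  have "\<phi> \<in> range (\<lambda>n. map_form ?g (from_nat n))" if "set_form \<phi> \<subseteq> P" for \<phi> :: "'p form"
  proof -
    have "map_form (?g \<circ> ?f) \<phi> = map_form id \<phi>"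
      using that by (intro form.map_cong0) (auto simp: from_nat_into_to_nat_on[OF assms])
    then have "map_form ?g (from_nat (to_nat (map_form ?f \<phi>))) = \<phi>"
      by (simp add: form.map_comp form.map_id0 form.map_id)
    then show ?thesis by (metis rangeI)
  qed
  then show thesis by (intro that) blast
qed

section \<open>Deducibility from sets of formulas\<close>

definition derives :: "'p language \<Rightarrow> 'p form set \<Rightarrow> 'p form \<Rightarrow> bool" where
  "derives L T \<phi> \<longleftrightarrow> (\<exists>\<Gamma>. set \<Gamma> \<subseteq> T \<and> deducible L \<Gamma> \<phi>)"

lemma derivesI: "deducible L \<Gamma> \<phi> \<Longrightarrow> set \<Gamma> \<subseteq> T \<Longrightarrow> derives L T \<phi>"
  by (auto simp: derives_def)

lemma derives_mono: "derives L T \<phi> \<Longrightarrow> T \<subseteq> T' \<Longrightarrow> derives L T' \<phi>"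
  by (auto simp: derives_def)

lemma derives_member: "\<phi> \<in> T \<Longrightarrow> wff L \<phi> \<Longrightarrow> derives L T \<phi>"
  by (rule derivesI[of _ "[\<phi>]"]) (auto intro: deducible.Assumption)

lemma derives_wff: "derives L T \<phi> \<Longrightarrow> language_wf L \<Longrightarrow> wff L \<phi>"
  using deducible_wff unfolding derives_def by blast

lemma derives_insertE:
  assumes "derives L (insert \<phi> T) \<psi>" "wff L \<phi>" "language_wf L"
  obtains \<Gamma> where "set \<Gamma> \<subseteq> T" "deducible L (\<phi> # \<Gamma>) \<psi>"
proof -
  obtain \<Delta> where \<Delta>: "set \<Delta> \<subseteq> insert \<phi> T" "deducible L \<Delta> \<psi>"
    using assms(1) by (auto simp: derives_def)
  show thesis
  proof (rule that[of "filter (\<lambda>\<theta>. \<theta> \<in> T) \<Delta>"])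
    show "deducible L (\<phi> # filter (\<lambda>\<theta>. \<theta> \<in> T) \<Delta>) \<psi>"
      using \<Delta>(1) deducible_wff[OF \<Delta>(2) assms(3)] assms(2,3)
      by (intro deducible_weaken[OF \<Delta>(2)]) auto
  qed auto
qed

lemma derives_Imp:
  assumes "derives L (insert \<phi> T) \<psi>" "wff L \<phi>" "language_wf L"
  shows "derives L T (Imp \<phi> \<psi>)"
  by (rule derives_insertE[OF assms]) (blast intro: derivesI deducible.ImpI)

lemma derives_pair:
  assumes "derives L T \<phi>" "derives L T \<psi>" "language_wf L"
  obtains \<Gamma> where "set \<Gamma> \<subseteq> T" "deducible L \<Gamma> \<phi>" "deducible L \<Gamma> \<psi>"
proof -
  obtain \<Gamma> \<Delta> where *: "set \<Gamma> \<subseteq> T" "deducible L \<Gamma> \<phi>" "set \<Delta> \<subseteq> T" "deducible L \<Delta> \<psi>"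
    using assms(1,2) by (auto simp: derives_def)
  have wff: "\<forall>\<theta>\<in>set (\<Gamma> @ \<Delta>). wff L \<theta>"
    using deducible_wff[OF *(2) assms(3)] deducible_wff[OF *(4) assms(3)] by auto
  show thesis
  proof (rule that[of "\<Gamma> @ \<Delta>"])
    show "set (\<Gamma> @ \<Delta>) \<subseteq> T" using *(1,3) by simp
    show "deducible L (\<Gamma> @ \<Delta>) \<phi>" by (rule deducible_weaken[OF *(2) _ wff assms(3)]) simp
    show "deducible L (\<Gamma> @ \<Delta>) \<psi>" by (rule deducible_weaken[OF *(4) _ wff assms(3)]) simp
  qed
qed

lemma derives_ImpE:
  assumes "derives L T (Imp \<phi> \<psi>)" "derives L T \<phi>" "language_wf L"
  shows "derives L T \<psi>"
  by (rule derives_pair[OF assms]) (blast intro: derivesI deducible.ImpE)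

lemma derives_cut:
  assumes "derives L T \<phi>" "derives L (insert \<phi> T) \<psi>" "language_wf L"
  shows "derives L T \<psi>"
proof -
  have "wff L \<phi>" by (rule derives_wff[OF assms(1,3)])
  then show ?thesis using derives_ImpE derives_Imp assms by blast
qed

lemma derives_Neg:
  assumes "derives L (insert \<phi> T) (Neg \<phi>)" "wff L \<phi>" "language_wf L"
  shows "derives L T (Neg \<phi>)"
proof (rule derives_insertE[OF assms])
  fix \<Gamma> assume \<Gamma>: "set \<Gamma> \<subseteq> T" "deducible L (\<phi> # \<Gamma>) (Neg \<phi>)"
  have "deducible L (\<phi> # \<Gamma>) \<phi>"
    using deducible_wff[OF \<Gamma>(2) assms(3)] by (intro deducible.Assumption) auto
  then show ?thesis using \<Gamma> by (blast intro: derivesI deducible.NegI)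
qed

text \<open>
  The two side derivations may use different finite parts of \<open>T\<close>. Replacing them by the
  implications that they prove reduces the rule to a derivation from three fixed hypotheses,
  followed by cuts.
\<close>

lemma derives_DisjE:
  assumes "derives L T (Disj \<phi> \<psi>)" "derives L (insert \<phi> T) \<chi>" "derives L (insert \<psi> T) \<chi>"
    and "language_wf L"
  shows "derives L T \<chi>"
proof -
  have wff: "wff L \<phi>" "wff L \<psi>" "wff L \<chi>"
    using derives_wff[OF assms(1,4)] derives_wff[OF assms(2,4)] by auto
  let ?\<Delta> = "[Disj \<phi> \<psi>, Imp \<phi> \<chi>, Imp \<psi> \<chi>]"
  have asm: "deducible L (\<Theta> @ ?\<Delta>) \<theta>" if "set \<Theta> \<subseteq> {\<phi>, \<psi>}" "\<theta> \<in> set (\<Theta> @ ?\<Delta>)" for \<Theta> \<theta>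
    using that wff by (intro deducible.Assumption) auto
  have "deducible L ([\<phi>] @ ?\<Delta>) \<chi>"
    by (rule deducible.ImpE[of _ _ \<phi>]; rule asm) auto
  moreover have "deducible L ([\<psi>] @ ?\<Delta>) \<chi>"
    by (rule deducible.ImpE[of _ _ \<psi>]; rule asm) auto
  moreover have "deducible L ?\<Delta> (Disj \<phi> \<psi>)" using asm[of "[]"] by simp
  ultimately have "deducible L ?\<Delta> \<chi>" using deducible.DisjE by simp
  then have "derives L {Disj \<phi> \<psi>, Imp \<phi> \<chi>, Imp \<psi> \<chi>} \<chi>" by (rule derivesI) simp
  then have "derives L (insert (Disj \<phi> \<psi>) (insert (Imp \<phi> \<chi>) (insert (Imp \<psi> \<chi>) T))) \<chi>"
    by (rule derives_mono) auto
  then show ?thesis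
    using derives_Imp[OF assms(2) wff(1) assms(4)] derives_Imp[OF assms(3) wff(2) assms(4)] assms(1)
    by (meson derives_cut derives_mono subset_insertI assms(4))
qed

lemma derives_Forall_fresh:
  assumes "derives L T (inst y \<phi>)" "\<forall>\<theta>\<in>T. y \<notin> fvars \<theta>" "y \<notin> fvars (Forall \<phi>)"
  shows "derives L T (Forall \<phi>)"
proof -
  obtain \<Gamma> where "set \<Gamma> \<subseteq> T" "deducible L \<Gamma> (inst y \<phi>)" using assms(1) by (auto simp: derives_def)
  then show ?thesis using assms(2,3) by (blast intro: derivesI deducible_Forall_fresh)
qed

lemma derives_Exists_fresh:
  assumes "derives L (insert (inst y \<phi>) T) \<chi>" "Exists \<phi> \<in> T" "wff L \<phi>" "language_wf L"
    and "\<forall>\<theta>\<in>T. y \<notin> fvars \<theta>" "y \<notin> fvars \<chi>"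
  shows "derives L T \<chi>"
proof -
  have "wff L (inst y \<phi>)" using assms(3) by simp
  then obtain \<Gamma> where \<Gamma>: "set \<Gamma> \<subseteq> T" "deducible L (inst y \<phi> # \<Gamma>) \<chi>"
    using derives_insertE[OF assms(1) _ assms(4)] by blast
  let ?\<Gamma> = "Exists \<phi> # \<Gamma>"
  have wff: "\<forall>\<theta>\<in>set (inst y \<phi> # ?\<Gamma>). wff L \<theta>"
    using deducible_wff[OF \<Gamma>(2) assms(4)] assms(3) by auto
  have cases: "deducible L (inst y \<phi> # ?\<Gamma>) \<chi>"
    by (rule deducible_weaken[OF \<Gamma>(2) _ wff assms(4)]) auto
  have "deducible L ?\<Gamma> (Exists \<phi>)" using wff by (intro deducible.Assumption) auto
  then have "deducible L ?\<Gamma> \<chi>"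
    by (rule deducible_Exists_fresh[OF _ cases]) (use \<Gamma>(1) assms(2,5,6) in auto)
  then show ?thesis by (rule derivesI) (use \<Gamma>(1) assms(2) in auto)
qed

section \<open>Saturated theories\<close>

definition formulas :: "'p language \<Rightarrow> 'p set \<Rightarrow> nat set \<Rightarrow> 'p form set" where
  "formulas L P V = {\<phi>. wff L \<phi> \<and> set_form \<phi> \<subseteq> P \<and> fvars \<phi> \<subseteq> V}"

text \<open>
  As there is no falsum, consistency is expressed by the proper inclusion: some formula over \<open>V\<close>
  is missing from \<open>T\<close>. The set \<open>V\<close> is the domain of the world with theory \<open>T\<close>.
\<close>

definition saturated :: "'p language \<Rightarrow> 'p set \<Rightarrow> nat set \<Rightarrow> 'p form set \<Rightarrow> bool" where
  "saturated L P V T \<longleftrightarrow>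
    T \<subset> formulas L P V \<and>
    (\<forall>\<phi>\<in>formulas L P V. derives L T \<phi> \<longrightarrow> \<phi> \<in> T) \<and>
    (\<forall>\<phi> \<psi>. Disj \<phi> \<psi> \<in> T \<longrightarrow> \<phi> \<in> T \<or> \<psi> \<in> T) \<and>
    (\<forall>\<phi>. Exists \<phi> \<in> T \<longrightarrow> (\<exists>y\<in>V. inst y \<phi> \<in> T))"

lemma saturated_subset: "saturated L P V T \<Longrightarrow> T \<subseteq> formulas L P V"
  by (auto simp: saturated_def)

lemma formulas_simps [simp]:
  "Neg \<phi> \<in> formulas L P V \<longleftrightarrow> \<phi> \<in> formulas L P V"
  "Conj \<phi> \<psi> \<in> formulas L P V \<longleftrightarrow> \<phi> \<in> formulas L P V \<and> \<psi> \<in> formulas L P V"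
  "Disj \<phi> \<psi> \<in> formulas L P V \<longleftrightarrow> \<phi> \<in> formulas L P V \<and> \<psi> \<in> formulas L P V"
  "Imp \<phi> \<psi> \<in> formulas L P V \<longleftrightarrow> \<phi> \<in> formulas L P V \<and> \<psi> \<in> formulas L P V"
  by (auto simp: formulas_def)

lemma formulas_wff: "\<phi> \<in> formulas L P V \<Longrightarrow> wff L \<phi>"
  by (simp add: formulas_def)

lemma formulas_mono: "V \<subseteq> V' \<Longrightarrow> formulas L P V \<subseteq> formulas L P V'"
  by (auto simp: formulas_def)

lemma formulas_inst:
  assumes "Forall \<phi> \<in> formulas L P V \<or> Exists \<phi> \<in> formulas L P V" "y \<in> V"
  shows "inst y \<phi> \<in> formulas L P V"
  using assms fvars_inst[of y \<phi>] by (auto simp: formulas_def)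

lemma infinite_fresh_insert:
  assumes "infinite (V - \<Union>(fvars ` T))"
  shows "infinite (V - \<Union>(fvars ` insert \<phi> T))"
proof -
  have "V - \<Union>(fvars ` insert \<phi> T) = (V - \<Union>(fvars ` T)) - fvars \<phi>" by auto
  then show ?thesis using Diff_infinite_finite[OF finite_fvars assms] by metis
qed

text \<open>
  One step of the Lindenbaum construction that keeps \<open>\<psi>\<close> underivable: \<open>\<phi>\<close> is added if this is
  harmless, together with a witness if it is existential. Each step uses up finitely many
  variables, so infinitely many fresh ones remain for later witnesses.
\<close>

lemma saturation_step:
  assumes lwf: "language_wf L"
    and T: "T \<subseteq> formulas L P V" "infinite (V - \<Union>(fvars ` T))" "\<not> derives L T \<psi>"
  shows "\<exists>T'. (T' \<subseteq> formulas L P V \<and> infinite (V - \<Union>(fvars ` T')) \<and> \<not> derives L T' \<psi>) \<and> T \<subseteq> T' \<and>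
    (\<phi> \<in> formulas L P V \<longrightarrow> derives L (insert \<phi> T) \<psi> \<or>
      \<phi> \<in> T' \<and> (\<forall>\<chi>. \<phi> = Exists \<chi> \<longrightarrow> (\<exists>y\<in>V. inst y \<chi> \<in> T')))"
proof (cases "\<phi> \<in> formulas L P V \<and> \<not> derives L (insert \<phi> T) \<psi>")
  case False
  then show ?thesis using T by blast
next
  case True
  note inf = infinite_fresh_insert[OF T(2), of \<phi>]
  show ?thesis
  proof (cases "\<exists>\<chi>. \<phi> = Exists \<chi>")
    case False
    then show ?thesis using True T inf by (intro exI[of _ "insert \<phi> T"]) auto
  next
    case ex: True
    then obtain \<chi> where \<chi>: "\<phi> = Exists \<chi>" by blast
    \<comment> \<open>The witness has to be fresh for \<open>\<psi>\<close> too, by the eigenvariable condition.\<close>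
    have "infinite (V - \<Union>(fvars ` insert \<psi> (insert \<phi> T)))"
      by (rule infinite_fresh_insert[OF inf])
    then obtain y where y: "y \<in> V" "y \<notin> fvars \<psi>" "\<forall>\<theta>\<in>insert \<phi> T. y \<notin> fvars \<theta>"
      by (auto dest!: infinite_imp_nonempty)
    have "wff L \<chi>" using True \<chi> formulas_wff by fastforce
    then have "\<not> derives L (insert (inst y \<chi>) (insert \<phi> T)) \<psi>"
      using derives_Exists_fresh[OF _ _ _ lwf y(3) y(2)] True \<chi> by blast
    moreover have "inst y \<chi> \<in> formulas L P V" using formulas_inst y(1) True \<chi> by blast
    ultimately show ?thesis
      using True T \<chi> y(1) infinite_fresh_insert[OF inf, of "inst y \<chi>"]
      by (intro exI[of _ "insert (inst y \<chi>) (insert \<phi> T)"]) auto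
  qed
qed

lemma derives_Union_chain:
  assumes "derives L (\<Union>n. S n) \<phi>" "\<And>n. S n \<subseteq> S (Suc n)"
  obtains n :: nat where "derives L (S n) \<phi>"
proof -
  obtain \<Gamma> where \<Gamma>: "set \<Gamma> \<subseteq> (\<Union>n. S n)" "deducible L \<Gamma> \<phi>" using assms(1) by (auto simp: derives_def)
  have mono: "S m \<subseteq> S n" if "m \<le> n" for m n by (rule lift_Suc_mono_le[of S, OF assms(2) that])
  have "\<exists>n. set \<Gamma> \<subseteq> S n" using \<Gamma>(1)
  proof (induction \<Gamma>)
    case (Cons \<theta> \<Gamma>)
    then obtain m n where "\<theta> \<in> S m" "set \<Gamma> \<subseteq> S n" by auto
    then have "set (\<theta> # \<Gamma>) \<subseteq> S (max m n)" using mono[of m "max m n"] mono[of n "max m n"] by auto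
    then show ?case by blast
  qed simp
  then show thesis using that \<Gamma>(2) derivesI by blast
qed

text \<open>
  Every formula is considered at some stage, so the limit is maximal among the theories over \<open>V\<close>
  that do not derive \<open>\<psi>\<close>: adding any further formula makes \<open>\<psi>\<close> derivable. Deductive closure
  follows by cut, and primeness by disjunction elimination, since \<open>\<psi>\<close> would be derivable from both
  disjuncts.
\<close>

lemma saturated_extension:
  assumes lwf: "language_wf L"
    and P: "countable P"
    and T: "T \<subseteq> formulas L P V" "infinite (V - \<Union>(fvars ` T))"
    and \<psi>: "\<psi> \<in> formulas L P V" "\<not> derives L T \<psi>"
  obtains T' where "saturated L P V T'" "T \<subseteq> T'" "\<psi> \<notin> T'"
proof -
  obtain enum :: "nat \<Rightarrow> _" where enum: "{\<phi>. set_form \<phi> \<subseteq> P} \<subseteq> range enum"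
    by (rule enumeration_of_formulas[OF P])
  define undecided where "undecided S \<longleftrightarrow>
      S \<subseteq> formulas L P V \<and> infinite (V - \<Union>(fvars ` S)) \<and> \<not> derives L S \<psi>" for S
  define decides where "decides n S S' \<longleftrightarrow> S \<subseteq> S' \<and>
      (enum n \<in> formulas L P V \<longrightarrow> derives L (insert (enum n) S) \<psi> \<or>
        enum n \<in> S' \<and> (\<forall>\<chi>. enum n = Exists \<chi> \<longrightarrow> (\<exists>y\<in>V. inst y \<chi> \<in> S')))" for n S S'
  have "\<exists>S. \<forall>n. (undecided (S n) \<and> (n = 0 \<longrightarrow> S n = T)) \<and> decides n (S n) (S (Suc n))"
  proof (rule dependent_nat_choice)
    show "\<exists>S. undecided S \<and> ((0::nat) = 0 \<longrightarrow> S = T)" using T \<psi>(2) by (simp add: undecided_def)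
  next
    fix S and n :: nat assume "undecided S \<and> (n = 0 \<longrightarrow> S = T)"
    then show "\<exists>S'. (undecided S' \<and> (Suc n = 0 \<longrightarrow> S' = T)) \<and> decides n S S'"
      using saturation_step[OF lwf, of S P V \<psi> "enum n"] by (simp add: undecided_def decides_def)
  qed
  then obtain S where chain: "\<forall>n. (undecided (S n) \<and> (n = 0 \<longrightarrow> S n = T)) \<and>
      decides n (S n) (S (Suc n))" ..
  have S: "\<And>n. undecided (S n)" "S 0 = T" "\<And>n. decides n (S n) (S (Suc n))"
    using chain by simp_all
  have S_formulas: "S n \<subseteq> formulas L P V" and S_not: "\<not> derives L (S n) \<psi>"
    and S_mono: "S n \<subseteq> S (Suc n)" for n
    using S(1)[of n] S(3)[of n] by (simp_all add: undecided_def decides_def)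
  define T' where "T' = (\<Union>n. S n)"
  have sub: "T' \<subseteq> formulas L P V" using S_formulas by (auto simp: T'_def)
  have not: "\<not> derives L T' \<psi>"
  proof
    assume "derives L T' \<psi>"
    then obtain n where "derives L (S n) \<psi>"
      unfolding T'_def by (rule derives_Union_chain) (rule S_mono)
    then show False using S_not by blast
  qed
  have S_sub: "S n \<subseteq> T'" for n by (auto simp: T'_def)
  have maximal: "\<phi> \<in> T' \<and> (\<forall>\<chi>. \<phi> = Exists \<chi> \<longrightarrow> (\<exists>y\<in>V. inst y \<chi> \<in> T'))"
    if "\<phi> \<in> formulas L P V" "\<not> derives L (insert \<phi> T') \<psi>" for \<phi>
  proof -
    have "\<phi> \<in> range enum" using enum that(1) by (auto simp: formulas_def)
    then obtain n where n: "\<phi> = enum n" by blast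
    then have "\<not> derives L (insert (enum n) (S n)) \<psi>"
      using that(2) derives_mono[of L "insert (enum n) (S n)" \<psi> "insert \<phi> T'"] S_sub[of n] by blast
    then have "enum n \<in> S (Suc n) \<and> (\<forall>\<chi>. enum n = Exists \<chi> \<longrightarrow> (\<exists>y\<in>V. inst y \<chi> \<in> S (Suc n)))"
      using S(3)[of n] that(1) n by (simp add: decides_def)
    then show ?thesis unfolding n using S_sub[of "Suc n"] by blast
  qed
  have closed: "\<phi> \<in> T'" if "\<phi> \<in> formulas L P V" "derives L T' \<phi>" for \<phi>
    using maximal[OF that(1)] derives_cut[OF that(2) _ lwf] not by blast
  have "\<psi> \<notin> T'" using not derives_member formulas_wff[OF \<psi>(1)] by blast
  moreover have "\<phi> \<in> T' \<or> \<chi> \<in> T'" if "Disj \<phi> \<chi> \<in> T'" for \<phi> \<chi>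
  proof (rule ccontr)
    assume "\<not> (\<phi> \<in> T' \<or> \<chi> \<in> T')"
    moreover have "\<phi> \<in> formulas L P V" "\<chi> \<in> formulas L P V" using that sub by auto
    moreover have "derives L T' (Disj \<phi> \<chi>)"
      using that sub formulas_wff by (intro derives_member) blast+
    ultimately show False using maximal derives_DisjE[OF _ _ _ lwf] not by blast
  qed
  moreover have "\<exists>y\<in>V. inst y \<phi> \<in> T'" if "Exists \<phi> \<in> T'" for \<phi>
    using maximal[of "Exists \<phi>"] that sub not by (auto simp: insert_absorb)
  ultimately have "saturated L P V T'"
    unfolding saturated_def using sub closed \<psi>(1) by blast
  then show thesis using that S(2) S_sub[of 0] \<open>\<psi> \<notin> T'\<close> by blast
qed

section \<open>Countably many refuting extensions\<close>

text \<open>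
  The condition on a later world, with domain \<open>V\<close> and theory \<open>T\<close>, that prevents an earlier world
  from forcing \<open>\<chi>\<close>. It is vacuous for the connectives whose forcing clause, in a model where \<open>LeG\<close>
  is equality, only concerns the earlier world itself, and for atoms.
\<close>

definition refutes :: "nat set \<Rightarrow> 'p form set \<Rightarrow> 'p form \<Rightarrow> bool" where
  "refutes V T \<chi> = (case \<chi> of
      Neg \<phi> \<Rightarrow> \<phi> \<in> T
    | Imp \<phi> \<psi> \<Rightarrow> \<phi> \<in> T \<and> \<psi> \<notin> T
    | Forall \<phi> \<Rightarrow> \<exists>y\<in>V. inst y \<phi> \<notin> T
    | _ \<Rightarrow> True)"

text \<open>
  If \<open>T\<close> does not contain \<open>\<not>\<phi>\<close>, then \<open>T\<close> with \<open>\<phi>\<close> does not derive \<open>\<not>\<phi>\<close>; if it does not contain \<open>\<phi>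
  \<longrightarrow> \<psi>\<close>, then \<open>T\<close> with \<open>\<phi>\<close> does not derive \<open>\<psi>\<close>; and if it does not contain \<open>\<forall>\<phi>\<close>, it does not derive
  the instance of \<open>\<phi>\<close> at a variable foreign to \<open>V\<close>. In each case \<open>saturated_extension\<close> keeps the
  underivable formula out. The infinitely many variables of \<open>V'\<close> outside \<open>V\<close> are available as
  witnesses.
\<close>

lemma refuting_extension:
  assumes lwf: "language_wf L"
    and P: "countable P"
    and T: "saturated L P V T"
    and V: "V \<subseteq> V'" "infinite (V' - V)"
    and \<chi>: "\<chi> \<in> formulas L P V" "\<chi> \<notin> T"
  obtains T' where "saturated L P V' T'" "T \<subseteq> T'" "refutes V' T' \<chi>"
proof -
  have T_sub: "T \<subseteq> formulas L P V" and closed: "\<And>\<phi>. \<phi> \<in> formulas L P V \<Longrightarrow> derives L T \<phi> \<Longrightarrow> \<phi> \<in> T"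
    using T by (auto simp: saturated_def)
  have mono: "formulas L P V \<subseteq> formulas L P V'" by (rule formulas_mono[OF V(1)])
  have extend: "\<exists>T'. saturated L P V' T' \<and> S \<subseteq> T' \<and> \<psi> \<notin> T'"
    if S: "S \<subseteq> formulas L P V" "\<psi> \<in> formulas L P V'" "\<not> derives L S \<psi>" for S \<psi>
  proof -
    have "V' - V \<subseteq> V' - \<Union>(fvars ` S)" using S(1) by (auto simp: formulas_def)
    then have inf: "infinite (V' - \<Union>(fvars ` S))" using V(2) finite_subset by blast
    have "S \<subseteq> formulas L P V'" using S(1) mono by blast
    then obtain T' where "saturated L P V' T'" "S \<subseteq> T'" "\<psi> \<notin> T'"
      by (rule saturated_extension[OF lwf P _ inf S(2,3)])
    then show ?thesis by blast
  qed
  have \<chi>_not: "\<not> derives L T \<chi>" using closed \<chi> by blast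
  have "\<exists>T'. saturated L P V' T' \<and> T \<subseteq> T' \<and> refutes V' T' \<chi>"
  proof (cases \<chi>)
    case (Neg \<phi>)
    have \<phi>: "\<phi> \<in> formulas L P V" using \<chi>(1) Neg by simp
    have "\<not> derives L (insert \<phi> T) (Neg \<phi>)"
      using derives_Neg[OF _ formulas_wff[OF \<phi>] lwf] \<chi>_not Neg by blast
    then obtain T' where "saturated L P V' T'" "insert \<phi> T \<subseteq> T'"
      using extend[of "insert \<phi> T" "Neg \<phi>"] \<phi> T_sub mono by auto
    then show ?thesis using Neg by (auto simp: refutes_def)
  next
    case (Imp \<phi> \<psi>)
    have \<phi>: "\<phi> \<in> formulas L P V" "\<psi> \<in> formulas L P V" using \<chi>(1) Imp by auto
    have "\<not> derives L (insert \<phi> T) \<psi>"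
      using derives_Imp[OF _ formulas_wff[OF \<phi>(1)] lwf] \<chi>_not Imp by blast
    then obtain T' where "saturated L P V' T'" "insert \<phi> T \<subseteq> T'" "\<psi> \<notin> T'"
      using extend[of "insert \<phi> T" \<psi>] \<phi> T_sub mono by auto
    then show ?thesis using Imp by (auto simp: refutes_def)
  next
    case (Forall \<phi>)
    obtain y where y: "y \<in> V'" "y \<notin> V" using V(2) by (auto dest!: infinite_imp_nonempty)
    have "\<forall>\<theta>\<in>T. y \<notin> fvars \<theta>" "y \<notin> fvars (Forall \<phi>)"
      using y(2) T_sub \<chi>(1) Forall by (auto simp: formulas_def)
    then have "\<not> derives L T (inst y \<phi>)" using derives_Forall_fresh \<chi>_not Forall by blast
    moreover have "inst y \<phi> \<in> formulas L P V'" using formulas_inst y(1) \<chi>(1) Forall mono by blast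
    ultimately obtain T' where "saturated L P V' T'" "T \<subseteq> T'" "inst y \<phi> \<notin> T'"
      using extend[of T "inst y \<phi>"] T_sub by auto
    then show ?thesis using Forall y(1) by (auto simp: refutes_def)
  qed (use extend[of T \<chi>] T_sub \<chi>(1) \<chi>_not mono in \<open>auto simp: refutes_def\<close>)
  then show thesis using that by blast
qed

text \<open>
  Closure of a family of theories under the extensions that the truth lemma asks for.
\<close>

definition refutation_complete ::
  "'p language \<Rightarrow> 'p set \<Rightarrow> ('w \<Rightarrow> nat set) \<Rightarrow> ('w \<Rightarrow> 'p form set) \<Rightarrow> bool" where
  "refutation_complete L P V T \<longleftrightarrow>
    (\<forall>w. saturated L P (V w) (T w) \<and>
      (\<forall>\<chi>\<in>formulas L P (V w) - T w. \<exists>w'. V w \<subseteq> V w' \<and> T w \<subseteq> T w' \<and> refutes (V w') (T w') \<chi>))"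

text \<open>
  The tree of theories. A node is the list of requests made on the way to it, most recent first,
  each request being the number of a formula that the next theory has to refute; its depth
  determines its domain.
\<close>

lemma refutation_complete_family:
  assumes lwf: "language_wf L"
    and P: "countable P"
    and T: "saturated L P (V 0) T0"
    and V: "\<And>n. V n \<subseteq> V (Suc n)" "\<And>n. infinite (V (Suc n) - V n)"
  obtains T :: "nat list \<Rightarrow> 'p form set"
  where "refutation_complete L P (\<lambda>w. V (length w)) T" "T [] = T0"
proof -
  obtain enum :: "nat \<Rightarrow> _" where enum: "{\<phi>. set_form \<phi> \<subseteq> P} \<subseteq> range enum"
    by (rule enumeration_of_formulas[OF P])
  define admissible where "admissible n k T T' \<longleftrightarrow> saturated L P (V (Suc n)) T' \<and> T \<subseteq> T' \<and>
      (enum k \<in> formulas L P (V n) - T \<longrightarrow> refutes (V (Suc n)) T' (enum k))" for n k T T'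
  have "\<exists>T'. admissible n k T T'" if sat: "saturated L P (V n) T" for n k T
  proof (cases "enum k \<in> formulas L P (V n) - T")
    case True
    then have "enum k \<in> formulas L P (V n)" "enum k \<notin> T" by auto
    then obtain T' where "saturated L P (V (Suc n)) T'" "T \<subseteq> T'" "refutes (V (Suc n)) T' (enum k)"
      by (rule refuting_extension[OF lwf P sat V])
    then show ?thesis by (auto simp: admissible_def)
  next
    case False
    \<comment> \<open>An invalid request is answered by some saturated extension, so that every list is a node.\<close>
    obtain \<psi> where "\<psi> \<in> formulas L P (V n)" "\<psi> \<notin> T" using sat by (auto simp: saturated_def)
    then obtain T' where "saturated L P (V (Suc n)) T'" "T \<subseteq> T'"
      by (rule refuting_extension[OF lwf P sat V])
    then show ?thesis using False by (auto simp: admissible_def)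
  qed
  moreover define next_theory where "next_theory n k T = (SOME T'. admissible n k T T')" for n k T
  ultimately have next_theory: "admissible n k T (next_theory n k T)"
    if "saturated L P (V n) T" for n k T
    using that by (simp add: someI_ex)
  define T where "T = rec_list T0 (\<lambda>k w. next_theory (length w) k)"
  have T_simps: "T [] = T0" "\<And>k w. T (k # w) = next_theory (length w) k (T w)"
    by (simp_all add: T_def)
  have sat: "saturated L P (V (length w)) (T w)" for w
    by (induction w) (use assms(3) next_theory in \<open>auto simp: T_simps admissible_def\<close>)
  have "\<exists>w'. V (length w) \<subseteq> V (length w') \<and> T w \<subseteq> T w' \<and> refutes (V (length w')) (T w') \<chi>"
    if \<chi>: "\<chi> \<in> formulas L P (V (length w)) - T w" for w \<chi>
  proof -
    have "\<chi> \<in> range enum" using enum \<chi> by (auto simp: formulas_def)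
    then obtain k where "\<chi> = enum k" by blast
    then show ?thesis
      using next_theory[OF sat[of w], of k] \<chi> V(1)
      by (intro exI[of _ "k # w"]) (simp add: T_simps admissible_def)
  qed
  then have "refutation_complete L P (\<lambda>w. V (length w)) T"
    using sat by (simp add: refutation_complete_def)
  then show thesis using that T_simps(1) by blast
qed

section \<open>The canonical model\<close>

text \<open>
  The elements of the domains are the variables themselves. With equality for \<open>LeG\<close>, this is an
  ordinary Kripke model.
\<close>

definition canonical_model ::
  "('w \<Rightarrow> nat set) \<Rightarrow> ('w \<Rightarrow> 'p form set) \<Rightarrow> ('w, nat, 'p) kripke_model" where
  "canonical_model V T = \<lparr>
    Worlds = UNIV,
    LeD = {(w, w'). V w \<subseteq> V w' \<and> T w \<subseteq> T w'},
    LeG = Id,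
    Dom = V,
    Interp = (\<lambda>w p. {xs. Atom p xs \<in> T w})\<rparr>"

lemma saturated_derivesD:
  assumes "saturated L P V T" "deducible L \<Gamma> \<phi>" "set \<Gamma> \<subseteq> T" "\<phi> \<in> formulas L P V"
  shows "\<phi> \<in> T"
  using assms derivesI unfolding saturated_def by blast

lemma saturated_identity_subst:
  assumes T: "saturated L P V T" and q: "identity L = Some q"
    and T_mem: "Atom q [x, y] \<in> T" "inst x \<phi> \<in> T" "inst y \<phi> \<in> formulas L P V"
  shows "inst y \<phi> \<in> T"
proof -
  let ?\<Gamma> = "[Atom q [x, y], inst x \<phi>]"
  have "set ?\<Gamma> \<subseteq> formulas L P V" using T_mem(1,2) saturated_subset[OF T] by auto
  then have wff: "\<forall>\<theta>\<in>set ?\<Gamma>. wff L \<theta>" using formulas_wff by blast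
  have "deducible L ?\<Gamma> (Atom q [x, y])" "deducible L ?\<Gamma> (inst x \<phi>)"
    by (rule deducible.Assumption[OF wff]; simp)+
  then have "deducible L ?\<Gamma> (inst y \<phi>)" by (rule deducible.IdentE[OF q])
  then show ?thesis by (rule saturated_derivesD[OF T]) (use T_mem in auto)
qed

text \<open>
  Symmetry replaces \<open>x\<close> by \<open>y\<close> in the first argument of \<open>x = x\<close>, and transitivity replaces \<open>y\<close> by
  \<open>z\<close> in the second argument of \<open>x = y\<close>.
\<close>

lemma saturated_identity_equiv:
  assumes lwf: "language_wf L" and T: "saturated L P V T" and q: "identity L = Some q" "q \<in> P"
  shows "equiv V {(x, y). Atom q [x, y] \<in> T}"
proof (rule equivI)
  have sub: "T \<subseteq> formulas L P V" by (rule saturated_subset[OF T])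
  have mem: "Atom q [x, y] \<in> formulas L P V" if "x \<in> V" "y \<in> V" for x y
    using that q lwf by (auto simp: formulas_def language_wf_def)
  show dom: "{(x, y). Atom q [x, y] \<in> T} \<subseteq> V \<times> V" using sub by (auto simp: formulas_def)
  show refl: "refl_on V {(x, y). Atom q [x, y] \<in> T}"
  proof (rule refl_onI)
    fix x assume "x \<in> V"
    moreover have "deducible L [] (Atom q [x, x])" by (rule deducible.IdentI[OF q(1)]) simp
    ultimately show "(x, x) \<in> {(x, y). Atom q [x, y] \<in> T}"
      using saturated_derivesD[OF T] mem by simp
  qed
  show "sym {(x, y). Atom q [x, y] \<in> T}"
  proof (rule symI, simp)
    fix x y assume xy: "Atom q [x, y] \<in> T"
    then have "x \<in> V" "y \<in> V" using dom by auto
    then show "Atom q [y, x] \<in> T"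
      using saturated_identity_subst[OF T q(1) xy, of "Atom q [0, Suc x]"] mem refl
      by (simp add: inst_def refl_on_def)
  qed
  show "trans {(x, y). Atom q [x, y] \<in> T}"
  proof (rule transI, simp)
    fix x y z assume xy: "Atom q [x, y] \<in> T" and yz: "Atom q [y, z] \<in> T"
    then have "x \<in> V" "z \<in> V" using dom by auto
    then show "Atom q [x, z] \<in> T"
      using saturated_identity_subst[OF T q(1) yz, of "Atom q [Suc x, 0]"] mem xy
      by (simp add: inst_def)
  qed
qed

text \<open>
  Identity elimination replaces one argument at a time; \<open>zs\<close> collects the arguments that have been
  dealt with.
\<close>

lemma saturated_identity_congruence:
  assumes T: "saturated L P V T" and q: "identity L = Some q"
    and eq: "list_all2 (\<lambda>x y. Atom q [x, y] \<in> T) xs ys"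
  shows "Atom p (zs @ xs) \<in> T \<Longrightarrow> Atom p (zs @ ys) \<in> T"
  using eq
proof (induction xs ys arbitrary: zs rule: list_all2_induct)
  case (Cons x xs y ys)
  have sub: "T \<subseteq> formulas L P V" by (rule saturated_subset[OF T])
  let ?\<phi> = "Atom p (map Suc zs @ 0 # map Suc xs)"
  have inst: "inst z ?\<phi> = Atom p (zs @ z # xs)" for z by (simp add: inst_def comp_def)
  have "y \<in> V" using Cons.hyps sub by (auto simp: formulas_def)
  moreover have "Atom p (zs @ x # xs) \<in> formulas L P V" using Cons.prems sub by blast
  ultimately have "Atom p (zs @ y # xs) \<in> formulas L P V" by (auto simp: formulas_def)
  then have "Atom p ((zs @ [y]) @ xs) \<in> T"
    using saturated_identity_subst[OF T q Cons.hyps(1), of ?\<phi>] Cons.prems by (simp add: inst)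
  then show ?case using Cons.IH[of "zs @ [y]"] by simp
qed simp

lemma canonical_model_potentialist:
  assumes lwf: "language_wf L" and P: "set_option (identity L) \<subseteq> P"
    and fam: "refutation_complete L P V T" and V: "\<And>w. V w \<noteq> {}"
  shows "potentialist_kripke_model L (canonical_model V T)"
proof -
  have sat: "saturated L P (V w) (T w)" for w using fam by (simp add: refutation_complete_def)
  then have sub: "T w \<subseteq> formulas L P (V w)" for w by (rule saturated_subset)
  have equiv: "equiv (V w) {(x, y). Atom q [x, y] \<in> T w}" if "identity L = Some q" for q w
    by (rule saturated_identity_equiv[OF lwf sat that]) (use that P in auto)
  have congr: "Atom p xs \<in> T w \<longleftrightarrow> Atom p ys \<in> T w"
    if q: "identity L = Some q" and xs: "list_all2 (\<lambda>x y. Atom q [x, y] \<in> T w) xs ys" for p q w xs ys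
  proof -
    have "list_all2 (\<lambda>x y. Atom q [x, y] \<in> T w) ys xs"
      using xs equiv[OF q, of w]
      by (auto simp: list_all2_conv_all_nth elim!: equivE dest: symD)
    then show ?thesis
      using saturated_identity_congruence[OF sat q, of w _ _ p "[]"] xs by auto
  qed
  show ?thesis
  proof
    fix w p
    show "Interp (canonical_model V T) w p
        \<subseteq> {as \<in> lists (Dom (canonical_model V T) w). length as = arity L p}"
      using sub[of w] by (fastforce simp: canonical_model_def formulas_def)
  next
    fix p q w as bs
    assume "identity L = Some q"
      "list_all2 (\<lambda>a b. [a, b] \<in> Interp (canonical_model V T) w q) as bs"
    then show "as \<in> Interp (canonical_model V T) w p \<longleftrightarrow> bs \<in> Interp (canonical_model V T) w p"
      using congr[of q w as bs p] by (simp add: canonical_model_def)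
  qed (use V equiv in \<open>auto simp: canonical_model_def preorder_on_def refl_on_def intro!: transI\<close>)
qed

text \<open>
  The induction is on the size of \<open>\<phi>\<close>, because the quantifier cases appeal to instances rather
  than to the body. Since variables denote themselves, evaluating the body at the element \<open>y\<close> is
  the same as evaluating the instance at the variable \<open>y\<close>, and the identity assignment suffices
  throughout. For negations, implications and universal formulas, deductive closure gives one
  direction and the refuting extensions the other; closure, primeness and witnesses settle
  conjunctions, disjunctions and existential formulas within the world.
\<close>

lemma truth_lemma:
  assumes fam: "refutation_complete L P V T"
  shows "\<phi> \<in> formulas L P (V w) \<Longrightarrow> forces (canonical_model V T) w (\<lambda>x. x) \<phi> \<longleftrightarrow> \<phi> \<in> T w"
proof (induction \<phi> arbitrary: w rule: measure_induct_rule[where f = size])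
  case (less \<phi>)
  let ?M = "canonical_model V T" and ?forces = "\<lambda>w. forces (canonical_model V T) w (\<lambda>x. x)"
  have LeD: "(w, w') \<in> LeD ?M \<longleftrightarrow> V w \<subseteq> V w' \<and> T w \<subseteq> T w'" for w w'
    by (simp add: canonical_model_def)
  have sat: "saturated L P (V w) (T w)" for w using fam by (simp add: refutation_complete_def)
  then have sub: "T w \<subseteq> formulas L P (V w)" for w by (rule saturated_subset)
  have up: "\<theta> \<in> formulas L P (V w')" if "\<theta> \<in> formulas L P (V w)" "(w, w') \<in> LeD ?M" for \<theta> w'
    using that formulas_mono LeD by blast
  have refutation: "\<exists>w'. (w, w') \<in> LeD ?M \<and> refutes (V w') (T w') \<phi>" if "\<phi> \<notin> T w"
    using fam less.prems that unfolding refutation_complete_def LeD by blast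
  have mem: "\<theta> \<in> T w'"
    if "deducible L \<Gamma> \<theta>" "set \<Gamma> \<subseteq> T w'" "\<theta> \<in> formulas L P (V w')" for \<Gamma> \<theta> w'
    by (rule saturated_derivesD[OF sat that])
  have asm: "deducible L \<Gamma> \<theta>" if "set \<Gamma> \<subseteq> T w'" "\<theta> \<in> set \<Gamma>" for \<Gamma> \<theta> w'
    using that sub formulas_wff by (intro deducible.Assumption) blast+
  show ?case
  proof (cases \<phi>)
    case (Atom p xs)
    then show ?thesis by (auto simp: canonical_model_def)
  next
    case (Neg \<psi>)
    have \<psi>: "\<psi> \<in> formulas L P (V w)" using less.prems Neg by simp
    have IH: "?forces w' \<psi> \<longleftrightarrow> \<psi> \<in> T w'" if "(w, w') \<in> LeD ?M" for w'
      using less.IH Neg up[OF \<psi> that] by simp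
    have "\<psi> \<notin> T w'" if "\<phi> \<in> T w" "(w, w') \<in> LeD ?M" for w'
    proof
      assume "\<psi> \<in> T w'"
      then have \<Gamma>: "set [\<psi>, Neg \<psi>] \<subseteq> T w'" using that Neg LeD by auto
      have "deducible L [\<psi>, Neg \<psi>] \<psi>" "deducible L [\<psi>, Neg \<psi>] (Neg \<psi>)" by (rule asm[OF \<Gamma>]; simp)+
      then have "\<theta> \<in> T w'" if "\<theta> \<in> formulas L P (V w')" for \<theta>
        using mem[OF deducible.NegE \<Gamma> that] formulas_wff[OF that] by blast
      then show False using sat[of w'] by (auto simp: saturated_def)
    qed
    moreover have "\<exists>w'. (w, w') \<in> LeD ?M \<and> \<psi> \<in> T w'" if "\<phi> \<notin> T w"
      using refutation[OF that] Neg by (simp add: refutes_def)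
    ultimately show ?thesis using IH Neg by auto
  next
    case (Conj \<psi> \<chi>)
    have "\<psi> \<in> formulas L P (V w)" "\<chi> \<in> formulas L P (V w)" using less.prems Conj by auto
    moreover have "\<psi> \<in> T w \<and> \<chi> \<in> T w" if "\<phi> \<in> T w"
    proof -
      have \<Gamma>: "set [Conj \<psi> \<chi>] \<subseteq> T w" using that Conj by simp
      have "deducible L [Conj \<psi> \<chi>] (Conj \<psi> \<chi>)" by (rule asm[OF \<Gamma>]) simp
      then show ?thesis using mem[OF _ \<Gamma>] calculation deducible.ConjE1 deducible.ConjE2 by blast
    qed
    moreover have "\<phi> \<in> T w" if "\<psi> \<in> T w" "\<chi> \<in> T w"
    proof -
      have \<Gamma>: "set [\<psi>, \<chi>] \<subseteq> T w" using that by simp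
      have "deducible L [\<psi>, \<chi>] \<psi>" "deducible L [\<psi>, \<chi>] \<chi>" by (rule asm[OF \<Gamma>]; simp)+
      then show ?thesis using mem[OF deducible.ConjI \<Gamma>] less.prems Conj by blast
    qed
    ultimately show ?thesis using less.IH[of \<psi> w] less.IH[of \<chi> w] Conj by auto
  next
    case (Disj \<psi> \<chi>)
    have *: "\<psi> \<in> formulas L P (V w)" "\<chi> \<in> formulas L P (V w)" using less.prems Disj by auto
    have "\<phi> \<in> T w" if "\<psi> \<in> T w"
    proof -
      have \<Gamma>: "set [\<psi>] \<subseteq> T w" using that by simp
      have "deducible L [\<psi>] \<psi>" by (rule asm[OF \<Gamma>]) simp
      then show ?thesis
        using mem[OF deducible.DisjI1 \<Gamma>] less.prems Disj formulas_wff[OF *(2)] by blast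
    qed
    moreover have "\<phi> \<in> T w" if "\<chi> \<in> T w"
    proof -
      have \<Gamma>: "set [\<chi>] \<subseteq> T w" using that by simp
      have "deducible L [\<chi>] \<chi>" by (rule asm[OF \<Gamma>]) simp
      then show ?thesis
        using mem[OF deducible.DisjI2 \<Gamma>] less.prems Disj formulas_wff[OF *(1)] by blast
    qed
    moreover have "\<psi> \<in> T w \<or> \<chi> \<in> T w" if "\<phi> \<in> T w"
      using that Disj sat[of w] by (simp add: saturated_def)
    ultimately show ?thesis using less.IH[of \<psi> w] less.IH[of \<chi> w] Disj * by auto
  next
    case (Imp \<psi> \<chi>)
    have *: "\<psi> \<in> formulas L P (V w)" "\<chi> \<in> formulas L P (V w)" using less.prems Imp by auto
    have IH: "?forces w' \<psi> \<longleftrightarrow> \<psi> \<in> T w'" "?forces w' \<chi> \<longleftrightarrow> \<chi> \<in> T w'" if "(w, w') \<in> LeD ?M" for w'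
      using less.IH[of \<psi> w'] less.IH[of \<chi> w'] Imp up[OF *(1) that] up[OF *(2) that] by simp_all
    have "\<chi> \<in> T w'" if "\<phi> \<in> T w" "(w, w') \<in> LeD ?M" "\<psi> \<in> T w'" for w'
    proof -
      have \<Gamma>: "set [Imp \<psi> \<chi>, \<psi>] \<subseteq> T w'" using that Imp LeD by auto
      have "deducible L [Imp \<psi> \<chi>, \<psi>] (Imp \<psi> \<chi>)" "deducible L [Imp \<psi> \<chi>, \<psi>] \<psi>"
        by (rule asm[OF \<Gamma>]; simp)+
      then show ?thesis using mem[OF deducible.ImpE \<Gamma> up[OF *(2) that(2)]] by blast
    qed
    moreover have "\<exists>w'. (w, w') \<in> LeD ?M \<and> \<psi> \<in> T w' \<and> \<chi> \<notin> T w'" if "\<phi> \<notin> T w"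
      using refutation[OF that] Imp by (simp add: refutes_def)
    ultimately show ?thesis using IH Imp by auto
  next
    case (Forall \<psi>)
    have inst: "inst y \<psi> \<in> formulas L P (V w')" if "(w, w') \<in> LeD ?M" "y \<in> V w'" for w' y
      using formulas_inst up[OF less.prems that(1)] that(2) Forall by blast
    have IH: "forces ?M w' (case_nat y (\<lambda>x. x)) \<psi> \<longleftrightarrow> inst y \<psi> \<in> T w'"
      if "(w, w') \<in> LeD ?M" "y \<in> V w'" for w' y
      using less.IH[of "inst y \<psi>" w'] inst[OF that] Forall by (simp add: size_inst forces_inst)
    have "inst y \<psi> \<in> T w'" if "\<phi> \<in> T w" "(w, w') \<in> LeD ?M" "y \<in> V w'" for w' y
    proof -
      have \<Gamma>: "set [Forall \<psi>] \<subseteq> T w'" using that(1,2) Forall LeD by auto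
      have "deducible L [Forall \<psi>] (Forall \<psi>)" by (rule asm[OF \<Gamma>]) simp
      then show ?thesis by (rule mem[OF deducible.ForallE \<Gamma> inst[OF that(2,3)]])
    qed
    moreover have "\<exists>w'. (w, w') \<in> LeD ?M \<and> (\<exists>y\<in>V w'. inst y \<psi> \<notin> T w')" if "\<phi> \<notin> T w"
      using refutation[OF that] Forall by (simp add: refutes_def)
    moreover have "?forces w \<phi> \<longleftrightarrow>
        (\<forall>w'. (w, w') \<in> LeD ?M \<longrightarrow> (\<forall>y\<in>V w'. inst y \<psi> \<in> T w'))"
      using IH Forall by (simp add: canonical_model_def)
    ultimately show ?thesis by blast
  next
    case (Exists \<psi>)
    have inst: "inst y \<psi> \<in> formulas L P (V w)" if "y \<in> V w" for y
      using formulas_inst less.prems that Exists by blast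
    have IH: "forces ?M w (case_nat y (\<lambda>x. x)) \<psi> \<longleftrightarrow> inst y \<psi> \<in> T w" if "y \<in> V w" for y
      using less.IH[of "inst y \<psi>" w] inst[OF that] Exists by (simp add: size_inst forces_inst)
    have "\<phi> \<in> T w" if "inst y \<psi> \<in> T w" for y
    proof -
      have \<Gamma>: "set [inst y \<psi>] \<subseteq> T w" using that by simp
      have "deducible L [inst y \<psi>] (inst y \<psi>)" by (rule asm[OF \<Gamma>]) simp
      then show ?thesis using mem[OF deducible.ExistsI \<Gamma>] less.prems Exists by blast
    qed
    moreover have "\<exists>y\<in>V w. inst y \<psi> \<in> T w" if "\<phi> \<in> T w"
      using that Exists sat[of w] by (simp add: saturated_def)
    moreover have "Dom ?M = V" "LeG ?M = Id" by (simp_all add: canonical_model_def)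
    ultimately show ?thesis using IH Exists by auto
  qed
qed

lemma completeness:
  assumes lwf: "language_wf L" and wff: "\<forall>\<phi>\<in>set \<Gamma>. wff L \<phi>" "wff L \<psi>"
    and not: "\<not> deducible L \<Gamma> \<psi>"
  shows "\<exists>M :: (nat, nat, 'p) kripke_model. potentialist_kripke_model L M \<and> \<not> preserves_forcing M \<Gamma> \<psi>"
proof -
  define P where "P = set_option (identity L) \<union> (\<Union>\<phi>\<in>insert \<psi> (set \<Gamma>). set_form \<phi>)"
  have "finite (set_form \<phi>)" for \<phi> :: "'p form" by (induction \<phi>) auto
  then have P: "countable P" by (simp add: P_def countable_finite)
  define F where "F = (\<Union>\<phi>\<in>insert \<psi> (set \<Gamma>). fvars \<phi>)"
  have F: "finite F" by (simp add: F_def)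
  \<comment> \<open>The variables of the sequent are in the domain of the root, and each level adds an infinite
    layer of a partition of the natural numbers into infinitely many infinite sets.\<close>
  define V where "V n = F \<union> {x. fst (prod_decode x) \<le> n}" for n
  have layer: "infinite {x. fst (prod_decode x) = n}" for n
  proof -
    have "range (\<lambda>i. prod_encode (n, i)) \<subseteq> {x. fst (prod_decode x) = n}" by auto
    moreover have "inj (\<lambda>i. prod_encode (n, i))" by (auto intro: injI)
    ultimately show ?thesis using range_inj_infinite infinite_super by blast
  qed
  have V_Suc: "V n \<subseteq> V (Suc n)" "infinite (V (Suc n) - V n)" for n
  proof -
    show "V n \<subseteq> V (Suc n)" by (auto simp: V_def)
    have "{x. fst (prod_decode x) = Suc n} - F \<subseteq> V (Suc n) - V n" by (auto simp: V_def)
    then show "infinite (V (Suc n) - V n)"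
      using Diff_infinite_finite[OF F layer] infinite_super by blast
  qed
  have inf: "infinite (V 0 - \<Union>(fvars ` set \<Gamma>))"
  proof -
    have "{x. fst (prod_decode x) = 0} - F \<subseteq> V 0 - \<Union>(fvars ` set \<Gamma>)" by (auto simp: V_def F_def)
    then show ?thesis using Diff_infinite_finite[OF F layer] infinite_super by blast
  qed
  have formulas: "insert \<psi> (set \<Gamma>) \<subseteq> formulas L P (V 0)"
    using wff by (auto simp: formulas_def P_def V_def F_def)
  have "\<not> derives L (set \<Gamma>) \<psi>"
  proof
    assume "derives L (set \<Gamma>) \<psi>"
    then obtain \<Delta> where "set \<Delta> \<subseteq> set \<Gamma>" "deducible L \<Delta> \<psi>" by (auto simp: derives_def)
    then show False using deducible_weaken[OF _ _ wff(1) lwf] not by blast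
  qed
  moreover have "\<psi> \<in> formulas L P (V 0)" "set \<Gamma> \<subseteq> formulas L P (V 0)" using formulas by auto
  ultimately obtain T0 where T0: "saturated L P (V 0) T0" "set \<Gamma> \<subseteq> T0" "\<psi> \<notin> T0"
    using saturated_extension[OF lwf P _ inf] by metis
  obtain T :: "nat list \<Rightarrow> _"
    where T: "refutation_complete L P (\<lambda>w. V (length w)) T" "T [] = T0"
    by (rule refutation_complete_family[OF lwf P T0(1) V_Suc])
  \<comment> \<open>Nodes are coded as natural numbers; 0 codes the empty list, that is, the root.\<close>
  let ?V = "\<lambda>w. V (length (list_decode w))" and ?T = "\<lambda>w. T (list_decode w)"
  let ?M = "canonical_model ?V ?T"
  have fam: "refutation_complete L P ?V ?T"
    unfolding refutation_complete_def
  proof (intro allI conjI ballI)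
    fix w \<chi>
    show "saturated L P (?V w) (?T w)" using T(1) by (simp add: refutation_complete_def)
    assume "\<chi> \<in> formulas L P (?V w) - ?T w"
    then obtain v where "?V w \<subseteq> V (length v) \<and> ?T w \<subseteq> T v \<and> refutes (V (length v)) (T v) \<chi>"
      using T(1) unfolding refutation_complete_def by blast
    then show "\<exists>w'. ?V w \<subseteq> ?V w' \<and> ?T w \<subseteq> ?T w' \<and> refutes (?V w') (?T w') \<chi>"
      by (intro exI[of _ "list_encode v"]) simp
  qed
  have "?V w \<noteq> {}" for w using V_Suc(2) by (auto simp: V_def intro!: exI[of _ "prod_encode (0, 0)"])
  then have model: "potentialist_kripke_model L ?M"
    by (intro canonical_model_potentialist[OF lwf _ fam]) (auto simp: P_def)
  have forces: "forces ?M 0 (\<lambda>x. x) \<phi> \<longleftrightarrow> \<phi> \<in> T0" if "\<phi> \<in> insert \<psi> (set \<Gamma>)" for \<phi>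
    using truth_lemma[OF fam, of \<phi> 0] formulas that T(2) by auto
  have "\<not> preserves_forcing ?M \<Gamma> \<psi>"
  proof
    assume preserves: "preserves_forcing ?M \<Gamma> \<psi>"
    have world: "0 \<in> Worlds ?M" by (simp add: canonical_model_def)
    have dom: "\<forall>\<phi>\<in>insert \<psi> (set \<Gamma>). \<forall>x\<in>fvars \<phi>. x \<in> Dom ?M 0"
      by (auto simp: canonical_model_def V_def F_def)
    have "\<forall>\<phi>\<in>set \<Gamma>. forces ?M 0 (\<lambda>x. x) \<phi>" using forces T0(2) by blast
    then have "forces ?M 0 (\<lambda>x. x) \<psi>"
      by (rule preserves[unfolded preserves_forcing_def, THEN bspec, OF world,
            THEN spec[of _ "\<lambda>x. x"], THEN mp, OF dom, THEN mp])
    then show False using forces T0(3) by blast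
  qed
  then show ?thesis using model by blast
qed

theorem theorem5:
  fixes L :: "'p language" and \<Gamma> :: "'p form list" and \<psi> :: "'p form"
  assumes "language_wf L"
    and "\<forall>\<phi>\<in>set \<Gamma>. wff L \<phi>"
    and "wff L \<psi>"
  shows "(deducible L \<Gamma> \<psi> \<longrightarrow>
      (\<forall>M :: ('w, 'd, 'p) kripke_model.
        potentialist_kripke_model L M \<longrightarrow> preserves_forcing M \<Gamma> \<psi>)) \<and>
    ((\<forall>M :: (nat, nat, 'p) kripke_model.
        potentialist_kripke_model L M \<longrightarrow> preserves_forcing M \<Gamma> \<psi>) \<longrightarrow>
      deducible L \<Gamma> \<psi>)"
proof (intro conjI impI allI)
  fix M :: "('w, 'd, 'p) kripke_model"
  assume "deducible L \<Gamma> \<psi>" "potentialist_kripke_model L M"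
  then show "preserves_forcing M \<Gamma> \<psi>"
    by (rule potentialist_kripke_model.deducible_preserves_forcing[rotated])
next
  assume "\<forall>M :: (nat, nat, 'p) kripke_model.
      potentialist_kripke_model L M \<longrightarrow> preserves_forcing M \<Gamma> \<psi>"
  then show "deducible L \<Gamma> \<psi>" using completeness[OF assms] by blast
qed

end
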